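(* Let $M$ be a compact smooth manifold without boundary, $\dim M=d$. Fix $t>0$ and a continuous density $p:M\to\mathbb{R}$ with $p(x)>0$ for all $x\in M$. Let $\iota_1,\iota_2:M\to\mathbb{R}^D$ be $C^2$ embeddings and, for $i=1,2$, denote the induced metrics by $g_i:=\iota_i^*\langle\cdot,\cdot\rangle_{\mathbb{R}^D}$, and set $$\mu_i:=\mu_{g_i},\qquad K_i(x,y):=\exp\Big(-\frac{\|\iota_i(x)-\iota_i(y)\|^2}{t}\Big).$$ Define the corresponding extrinsic continuous graph Laplace operators by $$(L^{\mathrm{ext}}_{t,p}(g_i;\iota_i)f)(x):=\frac{1}{t^{\frac d2+1}}\int_M K_i(x,y)\,\bigl(f(x)-f(y)\bigr)\,p(y)\,d\mu_i(y),\qquad f\in C(M),\ x\in M.$$ If $L^{\mathrm{ext}}_{t,p}(g_1;\iota_1)=L^{\mathrm{ext}}_{t,p}(g_2;\iota_2)$ as operators on $C(M)$, then $$\|\iota_1(x)-\iota_1(y)\|=\|\iota_2(x)-\iota_2(y)\|\quad\text{for all }x,y\in M,$$ and consequently $g_1=g_2$.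
   Context: $C(M)$ denotes the space of continuous real-valued functions on $M$. For a Riemannian metric $g$ on $M$, $\mu_g$ denotes its Riemannian volume measure. $\langle\cdot,\cdot\rangle_{\mathbb{R}^D}$ and $\|\cdot\|$ are the Euclidean inner product and norm on $\mathbb{R}^D$, and $\iota_i^*$ denotes pullback, so $g_i(x)(v,w)=\langle d\iota_i(x)[v],d\iota_i(x)[w]\rangle$. "Density" here just means a continuous strictly positive function; no normalization is imposed. *)

theory Defs
  imports "HOL-Analysis.Analysis"
begin

section \<open>Smooth manifolds\<close>

text \<open>
  For open \<open>S\<close> and finite-dimensional domain, \<open>C_on k S f\<close> says that \<open>f\<close> is of class
  \<open>C\<^sup>k\<close> on \<open>S\<close>.
\<close>

primrec C_on :: "nat \<Rightarrow> (real^'d) set \<Rightarrow> (real^'d \<Rightarrow> 'b::real_normed_vector) \<Rightarrow> bool" where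
  "C_on 0 S f \<longleftrightarrow> continuous_on S f"
| "C_on (Suc k) S f \<longleftrightarrow>
     (\<forall>x\<in>S. f differentiable (at x)) \<and> (\<forall>v. C_on k S (\<lambda>x. frechet_derivative f (at x) v))"

definition smooth_on :: "(real^'d) set \<Rightarrow> (real^'d \<Rightarrow> 'b::real_normed_vector) \<Rightarrow> bool" where
  "smooth_on S f \<longleftrightarrow> (\<forall>k. C_on k S f)"

text \<open>
  A chart \<open>(U, \<phi>)\<close> consists of its domain and its coordinate map; only the values of \<open>\<phi>\<close>
  on \<open>U\<close> matter.
\<close>

type_synonym ('m, 'd) chart = "'m set \<times> ('m \<Rightarrow> real^'d)"

abbreviation chart_dom :: "('m, 'd::finite) chart \<Rightarrow> 'm set" where
  "chart_dom c \<equiv> fst c"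

abbreviation chart_map :: "('m, 'd::finite) chart \<Rightarrow> 'm \<Rightarrow> real^'d" where
  "chart_map c \<equiv> snd c"

abbreviation chart_inv :: "('m, 'd::finite) chart \<Rightarrow> real^'d \<Rightarrow> 'm" where
  "chart_inv c \<equiv> inv_into (chart_dom c) (chart_map c)"

definition is_chart :: "'m::topological_space set \<Rightarrow> ('m, 'd::finite) chart \<Rightarrow> bool" where
  "is_chart M c \<longleftrightarrow>
     openin (top_of_set M) (chart_dom c) \<and>
     open (chart_map c ` chart_dom c) \<and>
     homeomorphism (chart_dom c) (chart_map c ` chart_dom c) (chart_map c) (chart_inv c)"

text \<open>
  A smooth manifold without boundary of dimension \<open>d = CARD('d) \<ge> 1\<close>: a topological space \<open>M\<close>
  (a subset of some type, with the subspace topology) with a smooth atlas, not required to be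
  maximal.
\<close>

definition smooth_manifold ::
  "'m::topological_space set \<Rightarrow> ('m, 'd::finite) chart set \<Rightarrow> bool" where
  "smooth_manifold M atlas \<longleftrightarrow>
     Hausdorff_space (top_of_set M) \<and>
     second_countable (top_of_set M) \<and>
     (\<forall>c\<in>atlas. is_chart M c) \<and>
     M = (\<Union>c\<in>atlas. chart_dom c) \<and>
     (\<forall>c\<in>atlas. \<forall>c'\<in>atlas.
        smooth_on (chart_map c ` (chart_dom c \<inter> chart_dom c')) (chart_map c' \<circ> chart_inv c))"

definition charts_at :: "('m, 'd::finite) chart set \<Rightarrow> 'm \<Rightarrow> ('m, 'd) chart set" where
  "charts_at atlas x = {c \<in> atlas. x \<in> chart_dom c}"


section \<open>Tangent vectors and differentials\<close>

text \<open>
  A tangent vector at \<open>x\<close> is the family of its coordinate vectors in all charts around \<open>x\<close>,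
  subject to the transformation law given by the differentials of the transition maps. The value
  \<open>0\<close> at all other charts is a normalisation that makes equality of tangent vectors equality of
  functions.
\<close>

type_synonym ('m, 'd) tangent = "('m, 'd) chart \<Rightarrow> real^'d"

definition tangent_space ::
  "('m, 'd::finite) chart set \<Rightarrow> 'm \<Rightarrow> ('m, 'd) tangent set" where
  "tangent_space atlas x =
     {v. (\<forall>c\<in>charts_at atlas x. \<forall>c'\<in>charts_at atlas x.
            v c' = frechet_derivative (chart_map c' \<circ> chart_inv c) (at (chart_map c x)) (v c)) \<and>
         (\<forall>c. c \<notin> charts_at atlas x \<longrightarrow> v c = 0)}"

text \<open>The coordinate vector \<open>\<partial>/\<partial>x\<^sub>i\<close> of the chart \<open>c\<close> at \<open>x\<close>.\<close>

definition coord_vector ::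
  "('m, 'd::finite) chart set \<Rightarrow> ('m, 'd) chart \<Rightarrow> 'm \<Rightarrow> 'd \<Rightarrow> ('m, 'd) tangent" where
  "coord_vector atlas c x i =
     (\<lambda>c'. if c' \<in> charts_at atlas x
           then frechet_derivative (chart_map c' \<circ> chart_inv c) (at (chart_map c x)) (axis i 1)
           else 0)"

text \<open>
  For differentiable \<open>f\<close> and \<open>v\<close> in the tangent space, the value does not depend on the chart
  chosen, by the transformation law and the chain rule.
\<close>

definition differential ::
  "('m, 'd::finite) chart set \<Rightarrow> ('m \<Rightarrow> real^'D) \<Rightarrow> 'm \<Rightarrow> ('m, 'd) tangent \<Rightarrow> real^'D" where
  "differential atlas f x v =
     (let c = (SOME c. c \<in> charts_at atlas x)
      in frechet_derivative (f \<circ> chart_inv c) (at (chart_map c x)) (v c))"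

definition C2_embedding ::
  "'m::topological_space set \<Rightarrow> ('m, 'd::finite) chart set \<Rightarrow> ('m \<Rightarrow> real^'D) \<Rightarrow> bool" where
  "C2_embedding M atlas \<iota> \<longleftrightarrow>
     (\<forall>c\<in>atlas. C_on 2 (chart_map c ` chart_dom c) (\<iota> \<circ> chart_inv c)) \<and>
     (\<forall>x\<in>M. inj_on (differential atlas \<iota> x) (tangent_space atlas x)) \<and>
     embedding_map (top_of_set M) euclidean \<iota>"


section \<open>Riemannian metrics and volume\<close>

text \<open>A metric is used only at points \<open>x\<close> of the manifold and on the tangent space at \<open>x\<close>.\<close>

type_synonym ('m, 'd) metric = "'m \<Rightarrow> ('m, 'd) tangent \<Rightarrow> ('m, 'd) tangent \<Rightarrow> real"

definition induced_metric ::
  "('m, 'd::finite) chart set \<Rightarrow> ('m \<Rightarrow> real^'D) \<Rightarrow> ('m, 'd) metric" where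
  "induced_metric atlas \<iota> = (\<lambda>x v w. differential atlas \<iota> x v \<bullet> differential atlas \<iota> x w)"

definition gram_matrix ::
  "('m, 'd::finite) chart set \<Rightarrow> ('m, 'd) metric \<Rightarrow> ('m, 'd) chart \<Rightarrow> 'm \<Rightarrow> real^'d^'d" where
  "gram_matrix atlas g c x =
     (\<chi> i j. g x (coord_vector atlas c x i) (coord_vector atlas c x j))"

text \<open>
  The Riemannian volume measure is the unique Borel measure on \<open>M\<close> that in every chart of the
  atlas is given by \<open>sqrt (det (g\<^sub>i\<^sub>j))\<close> times Lebesgue measure.
\<close>

definition is_riemannian_volume ::
  "'m::topological_space set \<Rightarrow> ('m, 'd::finite) chart set \<Rightarrow> ('m, 'd) metric \<Rightarrow> 'm measure \<Rightarrow> bool"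
  where
  "is_riemannian_volume M atlas g \<mu> \<longleftrightarrow>
     sets \<mu> = sets (restrict_space borel M) \<and>
     (\<forall>c\<in>atlas. \<forall>B\<in>sets \<mu>. B \<subseteq> chart_dom c \<longrightarrow>
        emeasure \<mu> B =
          (\<integral>\<^sup>+u\<in>chart_map c ` B.
             ennreal (sqrt (det (gram_matrix atlas g c (chart_inv c u)))) \<partial>lborel))"

definition riemannian_volume ::
  "'m::topological_space set \<Rightarrow> ('m, 'd::finite) chart set \<Rightarrow> ('m, 'd) metric \<Rightarrow> 'm measure" where
  "riemannian_volume M atlas g = (THE \<mu>. is_riemannian_volume M atlas g \<mu>)"


section \<open>The extrinsic graph Laplace operator\<close>

definition heat_kernel :: "real \<Rightarrow> ('m \<Rightarrow> real^'D) \<Rightarrow> 'm \<Rightarrow> 'm \<Rightarrow> real" where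
  "heat_kernel t \<iota> x y = exp (- ((norm (\<iota> x - \<iota> y))\<^sup>2 / t))"

definition ext_laplacian ::
  "'m::topological_space set \<Rightarrow> ('m, 'd::finite) chart set \<Rightarrow> real \<Rightarrow> ('m \<Rightarrow> real) \<Rightarrow>
   ('m, 'd) metric \<Rightarrow> ('m \<Rightarrow> real^'D) \<Rightarrow> ('m \<Rightarrow> real) \<Rightarrow> 'm \<Rightarrow> real" where
  "ext_laplacian M atlas t p g \<iota> f x =
     1 / t powr (real CARD('d) / 2 + 1) *
     (LINT y|riemannian_volume M atlas g. heat_kernel t \<iota> x y * (f x - f y) * p y)"

end

theory Submission
  imports Defs
begin

text \<open>The idea is that the kernel measure \<open>K\<^sub>i(x,\<cdot>) p \<mu>\<^sub>i\<close> can be read off from the operator away from the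
  point \<open>x\<close>, and that the Gaussian kernel is normalised to \<open>1\<close> on the diagonal.

  Fix \<open>x\<close> and test the operators on functions \<open>f\<close> with \<open>f x = 0\<close> that are concentrated near a point
  \<open>y \<noteq> x\<close>. In a chart around \<open>y\<close>, where \<open>\<mu>\<^sub>i\<close> has the continuous density \<open>\<rho>\<^sub>i\<close> (the square root of the Gram
  determinant), this gives \<open>K\<^sub>1(x,y) \<rho>\<^sub>1(y) = K\<^sub>2(x,y) \<rho>\<^sub>2(y)\<close>, because \<open>p(y) > 0\<close>; this is
  \<open>kernel_density_not_less\<close>, used twice. Now let \<open>x\<close> tend to \<open>y\<close>. The kernels tend to \<open>1\<close>, so
  \<open>\<rho>\<^sub>1(y) = \<rho>\<^sub>2(y)\<close>, and this number is positive because the embeddings are immersions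
  (\<open>vol_density_pos\<close>). Dividing, \<open>K\<^sub>1 = K\<^sub>2\<close>, which means that all distances agree. Differentiating the
  distances at a point shows that the two differentials have equal norms on every tangent vector, and
  by polarisation the metrics coincide.

  The analytic input is that the Riemannian volume measure exists, is unique, and has the expected
  density in charts (\<open>riemannian_volume_in_chart\<close>, \<open>integral_riemannian_volume_in_chart\<close>). The measures
  defined chart by chart agree on overlaps by the change-of-variables formula for nonnegative integrals
  (\<open>nn_integral_change_of_variables\<close>) together with the transformation rule for Gram determinants
  (\<open>vol_density_transition\<close>), and compatible local measures glue (\<open>ex1_glued_measure\<close>).\<close>

section \<open>Change of variables over a finite index type\<close>

text \<open>The theorem \<open>has_measure_differentiable_image\<close> speaks of vectors indexed by a well-ordered
  type, whereas the index type of a chart is merely finite and carries no order. The copy \<open>'a wo_copy\<close>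
  of a finite type receives its order from an injection into the natural numbers, so that a statement
  about \<open>real^'n\<close> can be proved on \<open>real^('n wo_copy)\<close> and pulled back along a relabelling of the
  coordinates. The relabelling changes neither Lebesgue measure nor Jacobian determinants.\<close>

typedef 'a wo_copy = "UNIV :: 'a set" morphisms orig copy_of by simp

lemma bij_orig: "bij (orig :: 'a wo_copy \<Rightarrow> 'a)"
  by (metis bijI' copy_of_inverse orig_inject UNIV_I)

instance wo_copy :: (finite) finite
proof
  have "finite (range (orig :: 'a wo_copy \<Rightarrow> 'a))"
    by simp
  then show "finite (UNIV :: 'a wo_copy set)"
    by (rule finite_imageD) (simp add: inj_on_def orig_inject)
qed

definition rank_of :: "'a::finite wo_copy \<Rightarrow> nat" where
  "rank_of = (SOME f. inj f)"

lemma inj_rank_of: "inj (rank_of :: 'a::finite wo_copy \<Rightarrow> nat)"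
proof -
  obtain f :: "'a wo_copy \<Rightarrow> nat" where "inj f"
    using finite_imp_inj_to_nat_seg[of "UNIV :: 'a wo_copy set"] by auto
  then show ?thesis
    unfolding rank_of_def by (rule someI[of inj])
qed

instantiation wo_copy :: (finite) wellorder
begin

definition "x \<le> y \<longleftrightarrow> rank_of x \<le> rank_of y"
definition "x < y \<longleftrightarrow> rank_of x < rank_of y"

instance
proof
  fix x y z :: "'a wo_copy" and P :: "'a wo_copy \<Rightarrow> bool"
  show "x < y \<longleftrightarrow> x \<le> y \<and> \<not> y \<le> x" "x \<le> x" "x \<le> y \<or> y \<le> x"
    by (auto simp: less_eq_wo_copy_def less_wo_copy_def)
  show "x \<le> y \<Longrightarrow> y \<le> z \<Longrightarrow> x \<le> z"
    by (auto simp: less_eq_wo_copy_def)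
  show "x \<le> y \<Longrightarrow> y \<le> x \<Longrightarrow> x = y"
    unfolding less_eq_wo_copy_def by (metis inj_rank_of injD order_antisym)
  assume *: "\<And>x. (\<And>y. y < x \<Longrightarrow> P y) \<Longrightarrow> P x"
  show "P x"
    by (induction x rule: measure_induct_rule[of rank_of]) (use * in \<open>auto simp: less_wo_copy_def\<close>)
qed

end

text \<open>Conjugation by \<open>f\<close> is a sign-preserving bijection between the permutations of the two index types,
  hence matches the terms of the two Leibniz sums.\<close>

lemma det_reindex:
  fixes A :: "real^'n::finite^'n" and f :: "'m::finite \<Rightarrow> 'n"
  assumes f: "bij f"
  shows "det (\<chi> i j. A $ f i $ f j) = det A"
proof -
  let ?G = "inv f"
  have inj: "inj f" "inj ?G" and invs: "\<And>y. f (?G y) = y" "\<And>x. ?G (f x) = x"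
    using f by (auto simp: bij_is_inj bij_imp_bij_inv bij_is_surj surj_f_inv_f)
  have map_f: "map_permutation UNIV f p = f \<circ> p \<circ> ?G" for p
    using f by (simp add: map_permutation_def restrict_id_def bij_is_surj fun_eq_iff)
  have sgn: "sign (f \<circ> p \<circ> ?G) = sign p" if "p permutes UNIV" for p
    using sign_map_permutation[of f UNIV p] that inj by (simp add: map_f)
  have "det A = (\<Sum>q | q permutes UNIV. of_int (sign q) * (\<Prod>i\<in>UNIV. A $ i $ q i))"
    by (simp add: det_def)
  also have "\<dots> = (\<Sum>p | p permutes UNIV. of_int (sign p) * (\<Prod>i\<in>UNIV. A $ f i $ f (p i)))"
  proof (rule sum.reindex_bij_witness[where j = "\<lambda>q. ?G \<circ> q \<circ> f" and i = "\<lambda>p. f \<circ> p \<circ> ?G"])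
    fix q :: "'n \<Rightarrow> 'n" assume q: "q \<in> {q. q permutes UNIV}"
    show "f \<circ> (?G \<circ> q \<circ> f) \<circ> ?G = q"
      by (simp add: fun_eq_iff invs)
    have "bij (?G \<circ> q \<circ> f)"
      using q f by (intro bij_comp bij_imp_bij_inv) (auto simp: permutes_bij)
    then have perm: "(?G \<circ> q \<circ> f) permutes UNIV"
      by (simp add: bij_iff permutes_def)
    then show "?G \<circ> q \<circ> f \<in> {p. p permutes UNIV}"
      by simp
    have "sign q = sign (?G \<circ> q \<circ> f)"
      using sgn[OF perm] by (simp add: o_def invs)
    moreover have "(\<Prod>i\<in>UNIV. A $ i $ q i) = (\<Prod>i\<in>UNIV. A $ f i $ q (f i))"
      using prod.reindex_bij_betw[OF f, of "\<lambda>i. A $ i $ q i"] by simp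
    ultimately show "of_int (sign (?G \<circ> q \<circ> f)) * (\<Prod>i\<in>UNIV. A $ f i $ f ((?G \<circ> q \<circ> f) i)) =
        of_int (sign q) * (\<Prod>i\<in>UNIV. A $ i $ q i)"
      by (simp add: invs)
  next
    fix p :: "'m \<Rightarrow> 'm" assume p: "p \<in> {q. q permutes UNIV}"
    show "?G \<circ> (f \<circ> p \<circ> ?G) \<circ> f = p"
      by (simp add: fun_eq_iff invs)
    have "bij (f \<circ> p \<circ> ?G)"
      using p f by (intro bij_comp bij_imp_bij_inv) (auto simp: permutes_bij)
    then show "f \<circ> p \<circ> ?G \<in> {p. p permutes UNIV}"
      by (simp add: bij_iff permutes_def)
  qed
  finally show ?thesis
    by (simp add: det_def)
qed

definition to_copy :: "real^'n::finite \<Rightarrow> real^('n wo_copy)" where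
  "to_copy x = (\<chi> i. x $ orig i)"

definition of_copy :: "real^('n wo_copy) \<Rightarrow> real^'n::finite" where
  "of_copy x = (\<chi> i. x $ copy_of i)"

lemma of_to_copy [simp]: "of_copy (to_copy x) = x" "to_copy (of_copy y) = y"
  by (simp_all add: to_copy_def of_copy_def vec_eq_iff copy_of_inverse orig_inverse)

lemma linear_copy: "linear to_copy" "linear of_copy"
  by (auto intro!: linearI simp: to_copy_def of_copy_def vec_eq_iff)

lemma bounded_linear_copy: "bounded_linear to_copy" "bounded_linear of_copy"
  using linear_copy by (simp_all add: linear_conv_bounded_linear)

lemma measurable_copy [measurable]:
  "to_copy \<in> borel_measurable borel" "of_copy \<in> borel_measurable borel"
  by (intro borel_measurable_continuous_onI linear_continuous_on bounded_linear_copy)+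

lemma prod_Basis_cart:
  fixes h :: "real^'n::finite \<Rightarrow> 'b::comm_monoid_mult"
  shows "(\<Prod>b\<in>Basis. h b) = (\<Prod>i\<in>UNIV. h (axis i (1::real)))"
proof -
  have "(Basis :: (real^'n) set) = range (\<lambda>i. axis i 1)"
    by (auto simp: Basis_vec_def)
  moreover have "inj (\<lambda>i::'n. axis i (1::real))"
    by (auto simp: inj_on_def axis_eq_axis)
  ultimately show ?thesis
    using prod.reindex[of "\<lambda>i. axis i (1::real)" "UNIV :: 'n set" h] by (simp only: o_def)
qed

text \<open>Lebesgue measure is determined by its values on boxes, and a relabelling only permutes the side
  lengths of a box.\<close>

lemma lborel_to_copy: "distr lborel borel (to_copy :: real^'n::finite \<Rightarrow> _) = lborel"
proof (rule lborel_eqI[symmetric])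
  fix l u :: "real^'n wo_copy"
  assume le: "\<And>b. b \<in> Basis \<Longrightarrow> l \<bullet> b \<le> u \<bullet> b"
  have le': "l $ i \<le> u $ i" for i
    using le[of "axis i 1"] by (simp add: axis_in_Basis_iff inner_axis)
  have "to_copy -` box l u = box (of_copy l) (of_copy u :: real^'n)"
  proof -
    have "(\<forall>i. l $ i < x $ orig i \<and> x $ orig i < u $ i) \<longleftrightarrow> (\<forall>i. l $ copy_of i < x $ i \<and> x $ i < u $ copy_of i)"
      for x :: "real^'n"
      by (metis UNIV_I copy_of_inverse orig_inverse)
    then show ?thesis
      by (simp add: set_eq_iff mem_box_cart to_copy_def of_copy_def)
  qed
  then have "emeasure (distr lborel borel (to_copy :: real^'n \<Rightarrow> _)) (box l u)
      = emeasure lborel (box (of_copy l) (of_copy u :: real^'n))"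
    by (subst emeasure_distr) auto
  also have "\<dots> = (\<Prod>b\<in>Basis. (of_copy u - of_copy l :: real^'n) \<bullet> b)"
    using le' by (subst emeasure_lborel_box) (auto simp: Basis_vec_def inner_axis of_copy_def)
  also have "(\<Prod>b\<in>Basis. (of_copy u - of_copy l :: real^'n) \<bullet> b) = (\<Prod>i\<in>UNIV. (u - l) $ copy_of i)"
    by (simp add: prod_Basis_cart inner_axis of_copy_def)
  also have "\<dots> = (\<Prod>i\<in>UNIV. (u - l) $ i)"
    by (intro prod.reindex_bij_witness[where i=orig and j=copy_of]) (auto simp: copy_of_inverse orig_inverse)
  also have "\<dots> = (\<Prod>b\<in>Basis. (u - l) \<bullet> b)"
    by (simp add: prod_Basis_cart inner_axis)
  finally show "emeasure (distr lborel borel (to_copy :: real^'n \<Rightarrow> _)) (box l u) = ennreal (\<Prod>b\<in>Basis. (u - l) \<bullet> b)" .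
qed simp

lemma nn_integral_lborel_copy:
  assumes [measurable]: "f \<in> borel_measurable borel"
  shows "(\<integral>\<^sup>+ y. f y \<partial>lborel) = (\<integral>\<^sup>+ x. f (to_copy x) \<partial>lborel)"
  by (subst lborel_to_copy[symmetric], subst nn_integral_distr) auto

text \<open>The theorem \<open>has_measure_differentiable_image\<close> equates two finite quantities and says that one of
  them is finite iff the other is. Treating the infinite case separately turns it into an equation in
  the extended reals, which is the form that measures need.\<close>

lemma emeasure_injective_image_wellorder:
  fixes g :: "real^'n::{finite,wellorder} \<Rightarrow> real^'n::_"
  assumes B: "B \<in> sets borel" and gB: "g ` B \<in> sets borel"
    and der: "\<And>x. x \<in> B \<Longrightarrow> (g has_derivative g' x) (at x)"
    and inj: "inj_on g B"
    and meas: "(\<lambda>x. indicator B x * \<bar>det (matrix (g' x))\<bar>) \<in> borel_measurable borel"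
  shows "emeasure lborel (g ` B) = (\<integral>\<^sup>+ x. ennreal (indicator B x * \<bar>det (matrix (g' x))\<bar>) \<partial>lborel)"
proof -
  let ?d = "\<lambda>x. \<bar>det (matrix (g' x))\<bar>"
  have der': "(g has_derivative g' x) (at x within B)" if "x \<in> B" for x
    using der[OF that] by (rule has_derivative_at_withinI)
  note image = has_measure_differentiable_image[OF _ der' inj]
  have B': "B \<in> sets lebesgue"
    using B by (simp add: sets_completionI_sets)
  show ?thesis
  proof (cases "(\<integral>\<^sup>+ x. ennreal (indicator B x * ?d x) \<partial>lborel) = \<infinity>")
    case False
    then obtain r where r: "r \<ge> 0" "(\<integral>\<^sup>+ x. ennreal (indicator B x * ?d x) \<partial>lborel) = ennreal r"
      by (cases "\<integral>\<^sup>+ x. ennreal (indicator B x * ?d x) \<partial>lborel" rule: ennreal_cases) auto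
    have "((\<lambda>x. indicator B x * ?d x) has_integral r) UNIV"
      using meas r by (intro nn_integral_has_integral) auto
    moreover have "(\<lambda>x. indicator B x * ?d x) = (\<lambda>x. if x \<in> B then ?d x else 0)"
      by (auto simp: indicator_def)
    ultimately have "(?d has_integral r) B"
      by (simp add: has_integral_restrict_UNIV)
    with image[where m=r] B' have *: "g ` B \<in> lmeasurable" "measure lebesgue (g ` B) = r"
      by auto
    then have "emeasure lebesgue (g ` B) = ennreal r"
      using emeasure_eq_ennreal_measure[OF fmeasurableD2] by fastforce
    with r gB show ?thesis by simp
  next
    case True
    have "emeasure lborel (g ` B) = \<infinity>"
    proof (rule ccontr)
      assume "emeasure lborel (g ` B) \<noteq> \<infinity>"
      then have "g ` B \<in> lmeasurable"
        using gB by (intro fmeasurableI) (auto simp: sets_completionI_sets less_top)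
      with image[where m="measure lebesgue (g ` B)"] B'
      have "(?d has_integral measure lebesgue (g ` B)) B"
        by auto
      from nn_integral_has_integral_lebesgue[OF _ this] True show False
        by simp
    qed
    with True show ?thesis by simp
  qed
qed

lemma emeasure_injective_image:
  fixes g :: "real^'n::finite \<Rightarrow> real^'n"
  assumes B: "B \<in> sets borel" and gB: "g ` B \<in> sets borel"
    and der: "\<And>x. x \<in> B \<Longrightarrow> (g has_derivative g' x) (at x)"
    and inj: "inj_on g B"
    and meas: "(\<lambda>x. indicator B x * \<bar>det (matrix (g' x))\<bar>) \<in> borel_measurable borel"
  shows "emeasure lborel (g ` B) = (\<integral>\<^sup>+ x. ennreal (indicator B x * \<bar>det (matrix (g' x))\<bar>) \<partial>lborel)"
proof -
  define h where "h = to_copy \<circ> g \<circ> of_copy"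
  define h' where "h' y = to_copy \<circ> g' (of_copy y) \<circ> of_copy" for y
  define C where "C = of_copy -` B"
  have img: "to_copy ` X = of_copy -` X" for X :: "(real^'n) set"
    by (auto simp: image_iff) (metis of_to_copy)
  have hC: "h ` C = of_copy -` (g ` B)"
    unfolding img[symmetric] C_def h_def by (force simp: image_iff)
  have der_h: "(h has_derivative h' y) (at y)" if "y \<in> C" for y
    unfolding h_def h'_def
    using that der[of "of_copy y"]
    by (intro diff_chain_at bounded_linear_imp_has_derivative bounded_linear_copy) (auto simp: C_def)
  have det_eq: "det (matrix (h' y)) = det (matrix (g' (of_copy y)))" for y
  proof -
    have ax: "of_copy (axis j 1) = axis (orig j) 1" for j :: "'n wo_copy"
      by (auto simp: of_copy_def axis_def vec_eq_iff copy_of_inverse orig_inverse)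
    have "matrix (h' y) = (\<chi> i j. matrix (g' (of_copy y)) $ orig i $ orig j)"
      by (simp add: matrix_def h'_def to_copy_def ax vec_eq_iff)
    then show ?thesis
      by (simp add: det_reindex[OF bij_orig])
  qed
  have ind: "indicator C y = (indicator B (of_copy y) :: real)" for y
    by (simp add: C_def indicator_def)
  have meas_h: "(\<lambda>y. indicator C y * \<bar>det (matrix (h' y))\<bar>) \<in> borel_measurable borel"
    unfolding det_eq ind by (rule measurable_compose[OF measurable_copy(2) meas])
  have "h ` C \<in> sets borel"
    using measurable_sets[OF measurable_copy(2) gB] unfolding hC by simp
  moreover have "C \<in> sets borel"
    using measurable_sets[OF measurable_copy(2) B] unfolding C_def by simp
  ultimately have sets: "C \<in> sets borel" "h ` C \<in> sets borel"
    by auto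
  have "inj_on h C"
  proof (rule inj_onI)
    fix x y assume xy: "x \<in> C" "y \<in> C" and "h x = h y"
    then have "g (of_copy x) = g (of_copy y)"
      unfolding h_def o_def by (metis of_to_copy(1))
    then have "of_copy x = of_copy y"
      using inj xy unfolding C_def by (auto dest: inj_onD)
    then show "x = y"
      by (metis of_to_copy(2))
  qed
  note eq = emeasure_injective_image_wellorder[OF sets der_h this meas_h]
  have "emeasure lborel (h ` C) = emeasure (distr lborel borel to_copy) (of_copy -` (g ` B))"
    by (simp add: lborel_to_copy hC)
  also have "\<dots> = emeasure lborel (to_copy -` (of_copy -` (g ` B)) :: (real^'n) set)"
    using sets(2) by (subst emeasure_distr) (auto simp: hC)
  also have "to_copy -` (of_copy -` (g ` B)) = g ` B"
    by auto
  finally have lhs: "emeasure lborel (h ` C) = emeasure lborel (g ` B)" .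
  have "(\<integral>\<^sup>+ y. ennreal (indicator C y * \<bar>det (matrix (h' y))\<bar>) \<partial>lborel)
      = (\<integral>\<^sup>+ x. ennreal (indicator B x * \<bar>det (matrix (g' x))\<bar>) \<partial>lborel)"
    using meas_h by (subst nn_integral_lborel_copy) (auto simp: det_eq ind)
  with eq lhs show ?thesis by simp
qed

text \<open>The formula for images of sets says that \<open>g\<close> pushes the measure with density \<open>\<bar>det g'\<bar>\<close> on \<open>S\<close> forward
  to Lebesgue measure on \<open>g ` S\<close>; integrating \<open>f\<close> against this equation of measures gives the claim.\<close>

lemma nn_integral_change_of_variables:
  fixes g :: "real^'n::finite \<Rightarrow> real^'n" and f :: "real^'n \<Rightarrow> ennreal"
  assumes S: "open S" and gS: "open (g ` S)"
    and der: "\<And>x. x \<in> S \<Longrightarrow> (g has_derivative g' x) (at x)"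
    and inj: "inj_on g S"
    and cont: "continuous_on S (\<lambda>x. det (matrix (g' x)))"
    and f: "f \<in> borel_measurable borel"
  shows "(\<integral>\<^sup>+ y\<in>g ` S. f y \<partial>lborel) = (\<integral>\<^sup>+ x\<in>S. ennreal \<bar>det (matrix (g' x))\<bar> * f (g x) \<partial>lborel)"
proof -
  let ?d = "\<lambda>x. ennreal (indicator S x * \<bar>det (matrix (g' x))\<bar>)"
  let ?R = "restrict_space lborel S"
  have [measurable]: "S \<in> sets borel" "g ` S \<in> sets borel"
    using S gS by auto
  have contg: "continuous_on S g"
    using der by (meson continuous_at_imp_continuous_on has_derivative_continuous)
  have [measurable]: "g \<in> borel_measurable ?R"
    using borel_measurable_continuous_on_restrict[OF contg] by (simp add: measurable_def sets_restrict_space space_restrict_space)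
  have md: "(\<lambda>x. indicator S x * \<bar>det (matrix (g' x))\<bar>) \<in> borel_measurable borel"
    using borel_measurable_continuous_on_indicator[OF borel_open[OF S] continuous_on_rabs[OF cont]]
    by simp
  then have [measurable]: "?d \<in> borel_measurable borel"
    by simp
  have mdR [simp]: "(\<lambda>x. indicator S x * \<bar>det (matrix (g' x))\<bar>) \<in> borel_measurable ?R"
    using md by (intro measurable_restrict_space1) simp
  then have [measurable]: "?d \<in> borel_measurable ?R"
    by simp
  have "density lborel (indicator (g ` S)) = distr (density ?R ?d) borel g"
  proof (rule measure_eqI)
    fix A assume "A \<in> sets (density lborel (indicator (g ` S) :: _ \<Rightarrow> ennreal))"
    then have A[measurable]: "A \<in> sets borel" by simp
    define B where "B = g -` A \<inter> S"
    have B[measurable]: "B \<in> sets borel"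
      using measurable_sets[OF \<open>g \<in> borel_measurable ?R\<close>, of A] A
      by (auto simp: B_def space_restrict_space sets_restrict_space_iff)
    have gB: "g ` B = g ` S \<inter> A"
      by (auto simp: B_def)
    have BS: "B \<subseteq> S" by (auto simp: B_def)
    have ind: "indicator B x * \<bar>det (matrix (g' x))\<bar> = indicator B x * (indicator S x * \<bar>det (matrix (g' x))\<bar>)" for x
      using BS by (auto simp: indicator_def)
    have "emeasure lborel (g ` B) = (\<integral>\<^sup>+ x. ennreal (indicator B x * \<bar>det (matrix (g' x))\<bar>) \<partial>lborel)"
    proof (rule emeasure_injective_image)
      show "g ` B \<in> sets borel" unfolding gB by measurable
      show "(\<lambda>x. indicator B x * \<bar>det (matrix (g' x))\<bar>) \<in> borel_measurable borel"
        unfolding ind using md by measurable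
    qed (use BS der inj B in \<open>auto intro: inj_on_subset\<close>)
    also have "\<dots> = (\<integral>\<^sup>+ x. ?d x * indicator B x * indicator S x \<partial>lborel)"
      using BS by (intro nn_integral_cong) (auto simp: indicator_def)
    also have "\<dots> = (\<integral>\<^sup>+ x. ?d x * indicator B x \<partial>?R)"
      by (subst nn_integral_restrict_space) auto
    also have "\<dots> = emeasure (density ?R ?d) B"
      using BS by (subst emeasure_density) (auto simp: sets_restrict_space_iff)
    also have "\<dots> = emeasure (distr (density ?R ?d) borel g) A"
      by (subst emeasure_distr) (auto simp: B_def space_restrict_space)
    finally have "emeasure (distr (density ?R ?d) borel g) A = emeasure lborel (g ` S \<inter> A)"
      by (simp add: gB)
    also have "\<dots> = emeasure (density lborel (indicator (g ` S))) A"
      by (subst emeasure_density) (auto simp flip: indicator_inter_arith nn_integral_indicator)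
    finally show "emeasure (density lborel (indicator (g ` S))) A = emeasure (distr (density ?R ?d) borel g) A" ..
  qed simp
  then have "(\<integral>\<^sup>+ y. f y \<partial>density lborel (indicator (g ` S))) = (\<integral>\<^sup>+ y. f y \<partial>distr (density ?R ?d) borel g)"
    by simp
  also have "\<dots> = (\<integral>\<^sup>+ x. f (g x) \<partial>density ?R ?d)"
    using f by (subst nn_integral_distr) auto
  also have "\<dots> = (\<integral>\<^sup>+ x. ?d x * f (g x) \<partial>?R)"
    using f by (subst nn_integral_density) auto
  also have "\<dots> = (\<integral>\<^sup>+ x. ?d x * f (g x) * indicator S x \<partial>lborel)"
    by (subst nn_integral_restrict_space) auto
  also have "\<dots> = (\<integral>\<^sup>+ x\<in>S. ennreal \<bar>det (matrix (g' x))\<bar> * f (g x) \<partial>lborel)"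
    by (intro nn_integral_cong) (auto simp: indicator_def)
  also have "(\<integral>\<^sup>+ y. f y \<partial>density lborel (indicator (g ` S))) = (\<integral>\<^sup>+ y\<in>g ` S. f y \<partial>lborel)"
    using f by (subst nn_integral_density) (auto simp: mult.commute)
  finally show ?thesis .
qed

section \<open>Gluing compatible measures\<close>

text \<open>Any set is the disjoint union of its pieces in the disjointed cover, and each piece lies in one
  member of the cover.\<close>

lemma measures_eq_on_cover:
  fixes \<mu> \<mu>' N :: "'a measure" and U :: "nat \<Rightarrow> 'a set"
  assumes sets: "sets \<mu> = sets N" "sets \<mu>' = sets N"
    and U: "\<And>n. U n \<in> sets N" and cover: "space N \<subseteq> (\<Union>n. U n)"
    and eq: "\<And>n B. B \<in> sets N \<Longrightarrow> B \<subseteq> U n \<Longrightarrow> emeasure \<mu> B = emeasure \<mu>' B"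
  shows "\<mu> = \<mu>'"
proof (rule measure_eqI)
  fix B assume "B \<in> sets \<mu>"
  then have B: "B \<in> sets N" by (simp add: sets)
  let ?D = "disjointed U"
  have D: "?D n \<in> sets N" for n
    using U sets.range_disjointed_sets[of U N] by auto
  have BD: "(\<lambda>n. B \<inter> ?D n) ` UNIV \<subseteq> sets N" "disjoint_family (\<lambda>n. B \<inter> ?D n)"
    using B D disjoint_family_disjointed[of U] by (auto simp: disjoint_family_on_def)
  have "space N \<subseteq> (\<Union>n. ?D n)"
    using cover by (simp add: UN_disjointed_eq)
  then have "(\<Union>n. B \<inter> ?D n) = B"
    using sets.sets_into_space[OF B] by blast
  then have "emeasure \<mu> B = (\<Sum>n. emeasure \<mu> (B \<inter> ?D n))" "emeasure \<mu>' B = (\<Sum>n. emeasure \<mu>' (B \<inter> ?D n))"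
    using suminf_emeasure[OF _ BD(2), of \<mu>] suminf_emeasure[OF _ BD(2), of \<mu>'] BD(1)
    by (simp_all add: sets)
  moreover have "emeasure \<mu> (B \<inter> ?D n) = emeasure \<mu>' (B \<inter> ?D n)" for n
    using B D disjointed_subset[of U n] by (intro eq) auto
  ultimately show "emeasure \<mu> B = emeasure \<mu>' B" by simp
qed (simp add: sets)

text \<open>Measures on the members of a cover that agree on overlaps glue to a unique measure: a set is cut
  along a disjointed countable subcover and each piece is measured by the measure of its own patch. The
  index set \<open>I\<close> may be uncountable; consistency on overlaps makes the result correct on all patches,
  not only on those of the subcover.\<close>

lemma ex1_glued_measure:
  fixes N :: "'a measure" and U :: "'i \<Rightarrow> 'a set" and \<nu> :: "'i \<Rightarrow> 'a measure"
  assumes U: "\<And>i. i \<in> I \<Longrightarrow> U i \<in> sets N"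
    and \<nu>: "\<And>i. i \<in> I \<Longrightarrow> sets (\<nu> i) = sets N"
    and s: "range s \<subseteq> I" and cover: "space N \<subseteq> (\<Union>n::nat. U (s n))"
    and agree: "\<And>i j B. i \<in> I \<Longrightarrow> j \<in> I \<Longrightarrow> B \<in> sets N \<Longrightarrow> B \<subseteq> U i \<Longrightarrow> B \<subseteq> U j \<Longrightarrow>
        emeasure (\<nu> i) B = emeasure (\<nu> j) B"
  shows "\<exists>!\<mu>. sets \<mu> = sets N \<and>
           (\<forall>i\<in>I. \<forall>B\<in>sets N. B \<subseteq> U i \<longrightarrow> emeasure \<mu> B = emeasure (\<nu> i) B)"
proof (rule ex_ex1I)
  let ?D = "disjointed (\<lambda>n. U (s n))"
  \<comment> \<open>Written as an integral over the counting measure, the sum over patches is countably additive by monotone convergence.\<close>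
  define m where "m B = (\<integral>\<^sup>+ n. emeasure (\<nu> (s n)) (B \<inter> ?D n) \<partial>count_space UNIV)" for B
  have sI: "s n \<in> I" for n using s by auto
  have D: "?D n \<in> sets N" for n
    using U sI sets.range_disjointed_sets[of "\<lambda>n. U (s n)" N] by auto
  have DU: "?D n \<subseteq> U (s n)" for n
    by (rule disjointed_subset)
  have disj: "disjoint_family ?D"
    by (rule disjoint_family_disjointed)
  have covD: "space N \<subseteq> (\<Union>n. ?D n)"
    using cover by (simp add: UN_disjointed_eq)
  define \<mu> where "\<mu> = measure_of (space N) (sets N) m"
  have em: "emeasure \<mu> B = m B" if "B \<in> sets N" for B
    unfolding \<mu>_def
  proof (rule emeasure_measure_of_sigma)
    show "sigma_algebra (space N) (sets N)" ..
    show "positive (sets N) m"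
      by (simp add: positive_def m_def)
    show "countably_additive (sets N) m"
      unfolding countably_additive_def
    proof (intro allI impI)
      fix A :: "nat \<Rightarrow> 'a set"
      assume A: "range A \<subseteq> sets N" "disjoint_family A" "(\<Union>i. A i) \<in> sets N"
      have "(\<Sum>i. m (A i)) = (\<integral>\<^sup>+ n. (\<Sum>i. emeasure (\<nu> (s n)) (A i \<inter> ?D n)) \<partial>count_space UNIV)"
        unfolding m_def by (rule nn_integral_suminf[symmetric]) simp
      also have "\<dots> = (\<integral>\<^sup>+ n. emeasure (\<nu> (s n)) ((\<Union>i. A i) \<inter> ?D n) \<partial>count_space UNIV)"
      proof (rule nn_integral_cong)
        fix n
        have "(\<Sum>i. emeasure (\<nu> (s n)) (A i \<inter> ?D n)) = emeasure (\<nu> (s n)) (\<Union>i. A i \<inter> ?D n)"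
          using A D \<nu>[OF sI] by (intro suminf_emeasure) (auto simp: disjoint_family_on_def)
        then show "(\<Sum>i. emeasure (\<nu> (s n)) (A i \<inter> ?D n)) = emeasure (\<nu> (s n)) ((\<Union>i. A i) \<inter> ?D n)"
          by simp
      qed
      finally show "(\<Sum>i. m (A i)) = m (\<Union>i. A i)"
        by (simp add: m_def)
    qed
  qed fact
  show "\<exists>\<mu>. sets \<mu> = sets N \<and> (\<forall>i\<in>I. \<forall>B\<in>sets N. B \<subseteq> U i \<longrightarrow> emeasure \<mu> B = emeasure (\<nu> i) B)"
  proof (intro exI[of _ \<mu>] conjI ballI impI)
    show sets_\<mu>: "sets \<mu> = sets N"
      by (simp add: \<mu>_def)
    fix i B assume i: "i \<in> I" and B: "B \<in> sets N" "B \<subseteq> U i"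
    have "emeasure \<mu> B = (\<Sum>n. emeasure (\<nu> (s n)) (B \<inter> ?D n))"
      by (simp add: em[OF B(1)] m_def nn_integral_count_space_nat)
    also have "\<dots> = (\<Sum>n. emeasure (\<nu> i) (B \<inter> ?D n))"
    proof (rule suminf_cong)
      fix n
      show "emeasure (\<nu> (s n)) (B \<inter> ?D n) = emeasure (\<nu> i) (B \<inter> ?D n)"
        using B D DU[of n] by (intro agree sI i) auto
    qed
    also have "\<dots> = emeasure (\<nu> i) (\<Union>n. B \<inter> ?D n)"
      using B D \<nu>[OF i] disjoint_family_subset[OF disj, of "\<lambda>n. B \<inter> ?D n"]
      by (intro suminf_emeasure) auto
    also have "(\<Union>n. B \<inter> ?D n) = B"
      using covD sets.sets_into_space[OF B(1)] by blast
    finally show "emeasure \<mu> B = emeasure (\<nu> i) B" .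
  qed
next
  fix \<mu> \<mu>' :: "'a measure"
  assume *: "sets \<mu> = sets N \<and> (\<forall>i\<in>I. \<forall>B\<in>sets N. B \<subseteq> U i \<longrightarrow> emeasure \<mu> B = emeasure (\<nu> i) B)"
     and **: "sets \<mu>' = sets N \<and> (\<forall>i\<in>I. \<forall>B\<in>sets N. B \<subseteq> U i \<longrightarrow> emeasure \<mu>' B = emeasure (\<nu> i) B)"
  show "\<mu> = \<mu>'"
  proof (rule measures_eq_on_cover[where N=N and U="\<lambda>n. U (s n)"])
    fix n B assume B: "B \<in> sets N" "B \<subseteq> U (s n)"
    have "s n \<in> I" using s by auto
    with B * ** show "emeasure \<mu> B = emeasure \<mu>' B" by simp
  next
    show "U (s n) \<in> sets N" for n
      using U s by auto
  qed (use * ** cover in simp_all)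
qed

section \<open>Gram determinants\<close>

definition gram :: "(real^'d::finite \<Rightarrow> real^'D) \<Rightarrow> real^'d^'d" where
  "gram L = (\<chi> i j. L (axis i 1) \<bullet> L (axis j 1))"

lemma linear_axis_expansion:
  fixes L :: "real^'d::finite \<Rightarrow> 'b::real_vector"
  assumes "linear L"
  shows "L x = (\<Sum>i\<in>UNIV. x $ i *\<^sub>R L (axis i 1))"
proof -
  have "L x = L (\<Sum>i\<in>UNIV. x $ i *\<^sub>R axis i 1)"
    by (simp only: basis_expansion[of x] flip: scalar_mult_eq_scaleR)
  also have "\<dots> = (\<Sum>i\<in>UNIV. x $ i *\<^sub>R L (axis i 1))"
    using assms by (simp add: linear_sum linear_scale)
  finally show ?thesis .
qed

lemma gram_compose:
  assumes L: "linear L" and A: "linear A"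
  shows "gram (L \<circ> A) = transpose (matrix A) ** gram L ** matrix A"
proof -
  have LA: "L (A (axis i 1)) = (\<Sum>k\<in>UNIV. matrix A $ k $ i *\<^sub>R L (axis k 1))" for i
    using linear_axis_expansion[OF L, of "A (axis i 1)"] by (simp add: matrix_def)
  have "gram (L \<circ> A) $ i $ j = (transpose (matrix A) ** gram L ** matrix A) $ i $ j" for i j
  proof -
    let ?a = "\<lambda>k i. matrix A $ k $ i" and ?e = "\<lambda>k. L (axis k 1)"
    have "gram (L \<circ> A) $ i $ j = (\<Sum>k\<in>UNIV. ?a k i *\<^sub>R ?e k) \<bullet> (\<Sum>l\<in>UNIV. ?a l j *\<^sub>R ?e l)"
      by (simp add: gram_def LA)
    also have "\<dots> = (\<Sum>l\<in>UNIV. \<Sum>k\<in>UNIV. ?a k i * (?e k \<bullet> ?e l) * ?a l j)"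
      by (subst inner_sum_right) (simp add: inner_sum_left sum_distrib_left mult.commute mult.left_commute)
    also have "\<dots> = (transpose (matrix A) ** gram L ** matrix A) $ i $ j"
      by (simp add: matrix_matrix_mult_def transpose_def gram_def sum_distrib_right)
    finally show ?thesis .
  qed
  then show ?thesis
    by (simp add: vec_eq_iff)
qed

lemma det_gram_compose:
  assumes "linear L" and "linear A"
  shows "det (gram (L \<circ> A)) = (det (matrix A))\<^sup>2 * det (gram L)"
  by (simp add: gram_compose[OF assms] det_mul det_transpose power2_eq_square)

lemma inner_gram:
  assumes L: "linear L"
  shows "(gram L *v x) \<bullet> x = (norm (L x))\<^sup>2"
proof -
  have "(norm (L x))\<^sup>2 = (\<Sum>i\<in>UNIV. x $ i *\<^sub>R L (axis i 1)) \<bullet> (\<Sum>i\<in>UNIV. x $ i *\<^sub>R L (axis i 1))"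
    using linear_axis_expansion[OF L, of x] by (simp add: power2_norm_eq_inner)
  also have "\<dots> = (gram L *v x) \<bullet> x"
  proof -
    let ?e = "\<lambda>k. L (axis k 1)"
    have "(gram L *v x) \<bullet> x = (\<Sum>i\<in>UNIV. \<Sum>j\<in>UNIV. x $ i * (x $ j * (?e j \<bullet> ?e i)))"
      by (subst inner_vec_def) (simp add: matrix_vector_mult_def gram_def sum_distrib_left
          sum_distrib_right mult.commute mult.left_commute inner_commute)
    then show ?thesis
      by (simp add: inner_sum_left inner_sum_right sum_distrib_left)
  qed
  finally show ?thesis by simp
qed

text \<open>The segment \<open>P s = (1 - s) I + s gram L\<close> consists of positive definite, hence invertible, matrices.
  So \<open>det (P s)\<close> never vanishes and keeps the sign that it has at the identity.\<close>

lemma det_gram_pos: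
  fixes L :: "real^'d::finite \<Rightarrow> real^'D"
  assumes L: "linear L" and inj: "inj L"
  shows "det (gram L) > 0"
proof (rule ccontr)
  assume neg: "\<not> det (gram L) > 0"
  define P where "P s = (1 - s) *\<^sub>R mat 1 + s *\<^sub>R gram L" for s :: real
  have nz: "det (P s) \<noteq> 0" if s: "0 \<le> s" "s \<le> 1" for s
  proof -
    have "x = 0" if "P s *v x = 0" for x
    proof (rule ccontr)
      assume x: "x \<noteq> 0"
      then have "L x \<noteq> 0"
        using inj linear_0[OF L] by (metis injD)
      then have pos: "(norm x)\<^sup>2 > 0" "(norm (L x))\<^sup>2 > 0"
        using x by auto
      have "(P s *v x) \<bullet> x = (1 - s) * (norm x)\<^sup>2 + s * (norm (L x))\<^sup>2"
        by (simp add: P_def matrix_vector_mult_add_rdistrib scaleR_matrix_vector_assoc[symmetric] inner_add_left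
            inner_gram[OF L] power2_norm_eq_inner)
      also have "\<dots> > 0"
      proof (cases "s = 0")
        case False
        with s pos show ?thesis by (intro add_nonneg_pos mult_nonneg_nonneg mult_pos_pos) auto
      qed (use pos in auto)
      finally show False using that by simp
    qed
    then have "invertible (P s)"
      by (simp add: invertible_left_inverse matrix_left_invertible_ker)
    then show ?thesis by (simp add: invertible_det_nz)
  qed
  have cont: "continuous_on {0..1} (\<lambda>s. det (P s))"
    unfolding det_def P_def by (auto intro!: continuous_intros)
  have "\<exists>s\<ge>0. s \<le> 1 \<and> det (P s) = 0"
  proof (rule IVT2')
    show "det (P 1) \<le> 0" "0 \<le> det (P 0)"
      using neg by (auto simp: P_def)
  qed (use cont in auto)
  with nz show False by auto
qed

section \<open>Charts and derivatives\<close>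

lemma C_on_imp_continuous_on:
  "C_on k S f \<Longrightarrow> continuous_on S f"
  by (cases k) (auto intro: differentiable_imp_continuous_within continuous_at_imp_continuous_on)

lemma C_on_SucD:
  assumes "C_on (Suc k) S f"
  shows "\<And>x. x \<in> S \<Longrightarrow> f differentiable (at x)"
    and "continuous_on S (\<lambda>x. frechet_derivative f (at x) v)"
proof -
  have *: "C_on k S (\<lambda>x. frechet_derivative f (at x) v)"
    using assms by simp
  show "\<And>x. x \<in> S \<Longrightarrow> f differentiable (at x)"
    using assms by simp
  show "continuous_on S (\<lambda>x. frechet_derivative f (at x) v)"
    using C_on_imp_continuous_on[OF *] .
qed

locale charted_manifold =
  fixes M :: "'m::topological_space set" and atlas :: "('m, 'd::finite) chart set"
  assumes manifold: "smooth_manifold M atlas"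
begin

lemma chart_homeo:
  assumes "c \<in> atlas"
  shows "openin (top_of_set M) (chart_dom c)" "open (chart_map c ` chart_dom c)"
    and "homeomorphism (chart_dom c) (chart_map c ` chart_dom c) (chart_map c) (chart_inv c)"
  using assms manifold unfolding smooth_manifold_def is_chart_def by blast+

lemma atlas_covers: "M = (\<Union>c\<in>atlas. chart_dom c)"
  using manifold unfolding smooth_manifold_def by (elim conjE)

lemma chart_inverse [simp]:
  assumes "c \<in> atlas"
  shows "x \<in> chart_dom c \<Longrightarrow> chart_inv c (chart_map c x) = x"
    and "u \<in> chart_map c ` chart_dom c \<Longrightarrow> chart_inv c u \<in> chart_dom c"
    and "u \<in> chart_map c ` chart_dom c \<Longrightarrow> chart_map c (chart_inv c u) = u"
  using chart_homeo(3)[OF assms] by (auto simp: homeomorphism_def)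

lemma inj_on_chart: "c \<in> atlas \<Longrightarrow> inj_on (chart_map c) (chart_dom c)"
  by (rule inj_on_inverseI[of _ "chart_inv c"]) simp

lemma continuous_chart_inv: "c \<in> atlas \<Longrightarrow> continuous_on (chart_map c ` chart_dom c) (chart_inv c)"
  using chart_homeo(3)[of c] by (simp add: homeomorphism_def)

lemma chart_dom_subset: "c \<in> atlas \<Longrightarrow> chart_dom c \<subseteq> M"
  by (subst atlas_covers) blast

lemma open_chart_image:
  assumes c: "c \<in> atlas" and V: "openin (top_of_set M) V" "V \<subseteq> chart_dom c"
  shows "open (chart_map c ` V)"
proof -
  have "openin (top_of_set (chart_dom c)) V"
    using V chart_dom_subset[OF c] by (meson openin_subset_trans)
  then have "openin (top_of_set (chart_map c ` chart_dom c)) (chart_map c ` V)"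
    using homeomorphism_imp_open_map[OF chart_homeo(3)[OF c]] by blast
  then show ?thesis
    using chart_homeo(2)[OF c] by (simp add: openin_open_eq)
qed

lemma open_overlap:
  assumes "c \<in> atlas" "c' \<in> atlas"
  shows "open (chart_map c ` (chart_dom c \<inter> chart_dom c'))"
  using assms by (intro open_chart_image openin_Int chart_homeo) auto

lemma transition_C1:
  assumes "c \<in> atlas" "c' \<in> atlas"
  shows "\<And>u. u \<in> chart_map c ` (chart_dom c \<inter> chart_dom c') \<Longrightarrow>
           (chart_map c' \<circ> chart_inv c) differentiable (at u)"
    and "continuous_on (chart_map c ` (chart_dom c \<inter> chart_dom c'))
           (\<lambda>u. frechet_derivative (chart_map c' \<circ> chart_inv c) (at u) v)"
proof -
  have "C_on (Suc 0) (chart_map c ` (chart_dom c \<inter> chart_dom c')) (chart_map c' \<circ> chart_inv c)"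
    using assms manifold unfolding smooth_manifold_def smooth_on_def by blast
  from C_on_SucD[OF this]
  show "\<And>u. u \<in> chart_map c ` (chart_dom c \<inter> chart_dom c') \<Longrightarrow>
           (chart_map c' \<circ> chart_inv c) differentiable (at u)"
    and "continuous_on (chart_map c ` (chart_dom c \<inter> chart_dom c'))
           (\<lambda>u. frechet_derivative (chart_map c' \<circ> chart_inv c) (at u) v)"
    by blast+
qed

text \<open>The chain rule behind every change of coordinates: it applies equally to a second chart map, which
  yields the cocycle rule for transition maps, and to an embedding.\<close>

lemma has_derivative_change_chart:
  fixes h :: "'m \<Rightarrow> 'b::real_normed_vector"
  assumes c: "c \<in> atlas" "x \<in> chart_dom c" and c': "c' \<in> atlas" "x \<in> chart_dom c'"
    and h: "(h \<circ> chart_inv c') differentiable (at (chart_map c' x))"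
  shows "((h \<circ> chart_inv c) has_derivative
           frechet_derivative (h \<circ> chart_inv c') (at (chart_map c' x)) \<circ>
           frechet_derivative (chart_map c' \<circ> chart_inv c) (at (chart_map c x))) (at (chart_map c x))"
proof -
  let ?W = "chart_map c ` (chart_dom c \<inter> chart_dom c')"
  have x: "chart_map c x \<in> ?W" using c c' by auto
  have "(chart_map c' \<circ> chart_inv c) (chart_map c x) = chart_map c' x"
    using c by simp
  then have "((h \<circ> chart_inv c') \<circ> (chart_map c' \<circ> chart_inv c) has_derivative
           frechet_derivative (h \<circ> chart_inv c') (at (chart_map c' x)) \<circ>
           frechet_derivative (chart_map c' \<circ> chart_inv c) (at (chart_map c x))) (at (chart_map c x))"
    using h transition_C1(1)[OF c(1) c'(1) x]
    by (intro diff_chain_at) (auto simp flip: frechet_derivative_works)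
  then show ?thesis
  proof (rule has_derivative_transform_within_open[OF _ open_overlap[OF c(1) c'(1)] x])
    fix u assume "u \<in> ?W"
    then show "((h \<circ> chart_inv c') \<circ> (chart_map c' \<circ> chart_inv c)) u = (h \<circ> chart_inv c) u"
      using c c' by auto
  qed
qed

lemma frechet_change_chart:
  fixes h :: "'m \<Rightarrow> 'b::real_normed_vector"
  assumes c: "c \<in> charts_at atlas x" and c': "c' \<in> charts_at atlas x"
    and h: "(h \<circ> chart_inv c') differentiable (at (chart_map c' x))"
  shows "frechet_derivative (h \<circ> chart_inv c) (at (chart_map c x)) v =
           frechet_derivative (h \<circ> chart_inv c') (at (chart_map c' x))
             (frechet_derivative (chart_map c' \<circ> chart_inv c) (at (chart_map c x)) v)"
  using frechet_derivative_at[OF has_derivative_change_chart[of c x c' h]] assms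
  by (simp add: charts_at_def o_def fun_eq_iff)

lemma frechet_identity_chart:
  assumes c: "c \<in> charts_at atlas x"
  shows "frechet_derivative (chart_map c \<circ> chart_inv c) (at (chart_map c x)) v = v"
proof -
  have c': "c \<in> atlas" "x \<in> chart_dom c" using c by (auto simp: charts_at_def)
  have "((\<lambda>u. u) has_derivative (\<lambda>v. v)) (at (chart_map c x))"
    by (rule has_derivative_ident)
  then have "((chart_map c \<circ> chart_inv c) has_derivative (\<lambda>v. v)) (at (chart_map c x))"
    by (rule has_derivative_transform_within_open[OF _ chart_homeo(2)[OF c'(1)]]) (use c' in auto)
  then show ?thesis
    by (metis frechet_derivative_at)
qed

text \<open>The tangent vector whose coordinates in the chart \<open>c\<close> are \<open>v\<close>; its coordinates in the other charts
  are then forced by the transformation law.\<close>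

definition tangent_of :: "('m, 'd) chart \<Rightarrow> 'm \<Rightarrow> real^'d \<Rightarrow> ('m, 'd) tangent" where
  "tangent_of c x v = (\<lambda>c'. if c' \<in> charts_at atlas x
     then frechet_derivative (chart_map c' \<circ> chart_inv c) (at (chart_map c x)) v else 0)"

lemma tangent_of_in_tangent_space:
  assumes c: "c \<in> charts_at atlas x"
  shows "tangent_of c x v \<in> tangent_space atlas x"
proof -
  have "frechet_derivative (chart_map c2 \<circ> chart_inv c) (at (chart_map c x)) v =
      frechet_derivative (chart_map c2 \<circ> chart_inv c1) (at (chart_map c1 x))
        (frechet_derivative (chart_map c1 \<circ> chart_inv c) (at (chart_map c x)) v)"
    if "c1 \<in> charts_at atlas x" "c2 \<in> charts_at atlas x" for c1 c2
    using that c by (intro frechet_change_chart transition_C1(1)) (auto simp: charts_at_def)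
  from this[symmetric] show ?thesis
    by (auto simp: tangent_space_def tangent_of_def)
qed

lemma tangent_of_same [simp]: "c \<in> charts_at atlas x \<Longrightarrow> tangent_of c x v c = v"
  by (simp add: tangent_of_def frechet_identity_chart)

lemma coord_vector_eq: "coord_vector atlas c x i = tangent_of c x (axis i 1)"
  by (simp add: coord_vector_def tangent_of_def)

lemma continuous_on_det_transition:
  assumes "c \<in> atlas" "c' \<in> atlas"
  shows "continuous_on (chart_map c ` (chart_dom c \<inter> chart_dom c'))
     (\<lambda>u. det (matrix (frechet_derivative (chart_map c' \<circ> chart_inv c) (at u))))"
  unfolding det_def matrix_def
  using transition_C1(2)[OF assms] by (auto intro!: continuous_intros)

end

locale embedded_manifold = charted_manifold M atlas
  for M :: "'m::topological_space set" and atlas :: "('m, 'd::finite) chart set" +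
  fixes \<iota> :: "'m \<Rightarrow> real^'D"
  assumes embedding: "C2_embedding M atlas \<iota>"
begin

abbreviation jac :: "('m, 'd) chart \<Rightarrow> real^'d \<Rightarrow> real^'d \<Rightarrow> real^'D" where
  "jac c u \<equiv> frechet_derivative (\<iota> \<circ> chart_inv c) (at u)"

lemma embedding_C1:
  assumes "c \<in> atlas"
  shows "\<And>u. u \<in> chart_map c ` chart_dom c \<Longrightarrow> (\<iota> \<circ> chart_inv c) differentiable (at u)"
    and "continuous_on (chart_map c ` chart_dom c) (\<lambda>u. jac c u v)"
proof -
  have "C_on (Suc (Suc 0)) (chart_map c ` chart_dom c) (\<iota> \<circ> chart_inv c)"
    using assms embedding by (simp add: C2_embedding_def numeral_2_eq_2)
  from C_on_SucD[OF this]
  show "\<And>u. u \<in> chart_map c ` chart_dom c \<Longrightarrow> (\<iota> \<circ> chart_inv c) differentiable (at u)"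
    and "continuous_on (chart_map c ` chart_dom c) (\<lambda>u. jac c u v)"
    by blast+
qed

lemma has_derivative_jac:
  assumes "c \<in> atlas" "u \<in> chart_map c ` chart_dom c"
  shows "((\<iota> \<circ> chart_inv c) has_derivative jac c u) (at u)"
  using embedding_C1(1)[OF assms] by (simp add: frechet_derivative_works)

lemma linear_jac:
  assumes "c \<in> atlas" "u \<in> chart_map c ` chart_dom c"
  shows "linear (jac c u)"
  using has_derivative_jac[OF assms] by (rule has_derivative_linear)

text \<open>The differential is defined through an arbitrarily selected chart. The transformation law of tangent
  vectors and the chain rule cancel, so every chart around the point computes it.\<close>

lemma differential_in_chart:
  assumes c: "c \<in> charts_at atlas x" and v: "v \<in> tangent_space atlas x"
  shows "differential atlas \<iota> x v = jac c (chart_map c x) (v c)"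
proof -
  define c0 where "c0 = (SOME c. c \<in> charts_at atlas x)"
  have c0: "c0 \<in> charts_at atlas x"
    unfolding c0_def using c by (rule someI[of "\<lambda>c. c \<in> charts_at atlas x"])
  have "jac c (chart_map c x) (v c) = jac c0 (chart_map c0 x)
      (frechet_derivative (chart_map c0 \<circ> chart_inv c) (at (chart_map c x)) (v c))"
    using c c0 by (intro frechet_change_chart embedding_C1(1)) (auto simp: charts_at_def)
  also have "frechet_derivative (chart_map c0 \<circ> chart_inv c) (at (chart_map c x)) (v c) = v c0"
    using v c c0 unfolding tangent_space_def by (blast dest: sym)
  finally show ?thesis
    unfolding differential_def Let_def c0_def[symmetric] ..
qed

text \<open>The immersion condition, stated on the abstract tangent space, transferred to coordinates.\<close>

lemma inj_jac:
  assumes c: "c \<in> charts_at atlas x"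
  shows "inj (jac c (chart_map c x))"
proof (rule injI)
  fix v w assume "jac c (chart_map c x) v = jac c (chart_map c x) w"
  then have "differential atlas \<iota> x (tangent_of c x v) = differential atlas \<iota> x (tangent_of c x w)"
    using c by (simp add: differential_in_chart[OF c] tangent_of_in_tangent_space)
  moreover have "inj_on (differential atlas \<iota> x) (tangent_space atlas x)"
    using embedding c chart_dom_subset[of c] by (auto simp: C2_embedding_def charts_at_def)
  ultimately have "tangent_of c x v = tangent_of c x w"
    using tangent_of_in_tangent_space[OF c] by (auto dest: inj_onD)
  then show "v = w"
    using tangent_of_same[OF c] by metis
qed

definition vol_density :: "('m, 'd) chart \<Rightarrow> real^'d \<Rightarrow> real" where
  "vol_density c u = sqrt (det (gram (jac c u)))"

lemma gram_matrix_in_chart: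
  assumes c: "c \<in> charts_at atlas x"
  shows "gram_matrix atlas (induced_metric atlas \<iota>) c x = gram (jac c (chart_map c x))"
proof -
  have "differential atlas \<iota> x (coord_vector atlas c x i) = jac c (chart_map c x) (axis i 1)" for i
    unfolding coord_vector_eq differential_in_chart[OF c tangent_of_in_tangent_space[OF c]] tangent_of_same[OF c] ..
  then show ?thesis
    by (simp only: gram_matrix_def gram_def induced_metric_def)
qed

lemma vol_density_eq:
  assumes "c \<in> atlas" "u \<in> chart_map c ` chart_dom c"
  shows "sqrt (det (gram_matrix atlas (induced_metric atlas \<iota>) c (chart_inv c u))) = vol_density c u"
proof -
  have "c \<in> charts_at atlas (chart_inv c u)"
    using assms by (simp add: charts_at_def)
  from gram_matrix_in_chart[OF this] show ?thesis
    unfolding chart_inverse(3)[OF assms] vol_density_def by simp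
qed

lemma vol_density_pos:
  assumes "c \<in> atlas" "u \<in> chart_map c ` chart_dom c"
  shows "vol_density c u > 0"
proof -
  have "c \<in> charts_at atlas (chart_inv c u)"
    using assms by (simp add: charts_at_def)
  from inj_jac[OF this] have "inj (jac c u)"
    unfolding chart_inverse(3)[OF assms] .
  with linear_jac[OF assms] show ?thesis
    unfolding vol_density_def by (simp add: det_gram_pos)
qed

lemma continuous_on_vol_density:
  assumes "c \<in> atlas"
  shows "continuous_on (chart_map c ` chart_dom c) (vol_density c)"
  unfolding vol_density_def det_def gram_def
  using embedding_C1(2)[OF assms] by (auto intro!: continuous_intros)

text \<open>Under a transition map with derivative \<open>A\<close> the Gram determinant picks up the factor \<open>(det A)\<^sup>2\<close>. Its
  square root is exactly the Jacobian factor of the change-of-variables formula, which is why the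
  chart measures below are compatible.\<close>

lemma vol_density_transition:
  assumes c: "c \<in> charts_at atlas x" and c': "c' \<in> charts_at atlas x"
  shows "vol_density c (chart_map c x) =
    \<bar>det (matrix (frechet_derivative (chart_map c' \<circ> chart_inv c) (at (chart_map c x))))\<bar> *
    vol_density c' (chart_map c' x)"
proof -
  let ?A = "frechet_derivative (chart_map c' \<circ> chart_inv c) (at (chart_map c x))"
  have cc': "c \<in> atlas" "x \<in> chart_dom c" "c' \<in> atlas" "x \<in> chart_dom c'"
    using c c' by (auto simp: charts_at_def)
  have "jac c (chart_map c x) = jac c' (chart_map c' x) \<circ> ?A"
    using frechet_change_chart[OF c c' embedding_C1(1)] cc' by (auto simp: fun_eq_iff)
  moreover have "linear ?A"
    using transition_C1(1)[OF cc'(1,3), of "chart_map c x"] cc'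
    by (intro linear_frechet_derivative) auto
  ultimately show ?thesis
    using linear_jac[of c' "chart_map c' x"] cc'
    by (simp add: vol_density_def det_gram_compose real_sqrt_mult)
qed

section \<open>The Riemannian volume measure\<close>

text \<open>The Riemannian volume of the chart domain, extended by zero to all of \<open>M\<close>: the measures of all charts
  then share one sigma-algebra, as the gluing requires.\<close>

definition chart_vol :: "('m, 'd) chart \<Rightarrow> 'm measure" where
  "chart_vol c = distr (density (restrict_space lborel (chart_map c ` chart_dom c)) (\<lambda>u. ennreal (vol_density c u)))
     (restrict_space borel M) (chart_inv c)"

lemma sets_chart_vol [simp, measurable_cong]: "sets (chart_vol c) = sets (restrict_space borel M)"
  by (simp add: chart_vol_def)

lemma chart_inv_measurable:
  assumes "c \<in> atlas"
  shows "chart_inv c \<in> restrict_space lborel (chart_map c ` chart_dom c) \<rightarrow>\<^sub>M restrict_space borel M"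
proof (rule measurable_restrict_space2)
  show "chart_inv c \<in> space (restrict_space lborel (chart_map c ` chart_dom c)) \<rightarrow> M"
    using assms chart_dom_subset[OF assms] by (auto simp: space_restrict_space)
  show "chart_inv c \<in> borel_measurable (restrict_space lborel (chart_map c ` chart_dom c))"
    using borel_measurable_continuous_on_restrict[OF continuous_chart_inv[OF assms]]
    by (simp add: measurable_def sets_restrict_space space_restrict_space)
qed

lemma vol_density_measurable:
  assumes "c \<in> atlas"
  shows "vol_density c \<in> borel_measurable (restrict_space lborel (chart_map c ` chart_dom c))"
  using borel_measurable_continuous_on_restrict[OF continuous_on_vol_density[OF assms]]
  by (simp add: measurable_def sets_restrict_space space_restrict_space)

lemma chart_image_eq:
  assumes "c \<in> atlas" "B \<subseteq> chart_dom c"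
  shows "chart_map c ` B = chart_inv c -` B \<inter> chart_map c ` chart_dom c"
  using assms by (auto simp: subset_iff image_iff)

lemma chart_image_borel:
  assumes c: "c \<in> atlas" and B: "B \<in> sets (restrict_space borel M)" "B \<subseteq> chart_dom c"
  shows "chart_map c ` B \<in> sets borel"
  using measurable_sets[OF chart_inv_measurable[OF c] B(1)] chart_homeo(2)[OF c]
  by (simp add: chart_image_eq[OF c B(2)] space_restrict_space sets_restrict_space_iff)

lemma emeasure_chart_vol:
  assumes c: "c \<in> atlas" and B: "B \<in> sets (restrict_space borel M)" "B \<subseteq> chart_dom c"
  shows "emeasure (chart_vol c) B = (\<integral>\<^sup>+ u\<in>chart_map c ` B. ennreal (vol_density c u) \<partial>lborel)"
proof -
  let ?V = "chart_map c ` chart_dom c"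
  let ?R = "restrict_space lborel ?V"
  have sub: "chart_map c ` B \<subseteq> ?V" using B by auto
  have inB: "chart_map c ` B \<in> sets ?R"
    using chart_image_borel[OF c B] sub chart_homeo(2)[OF c] by (simp add: sets_restrict_space_iff)
  have "emeasure (chart_vol c) B = emeasure (density ?R (\<lambda>u. ennreal (vol_density c u))) (chart_map c ` B)"
    unfolding chart_vol_def
    using chart_inv_measurable[OF c] B
    by (subst emeasure_distr) (auto simp: space_restrict_space chart_image_eq[OF c B(2)])
  also have "\<dots> = (\<integral>\<^sup>+ u. ennreal (vol_density c u) * indicator (chart_map c ` B) u \<partial>?R)"
    using vol_density_measurable[OF c] inB by (subst emeasure_density) auto
  also have "\<dots> = (\<integral>\<^sup>+ u. ennreal (vol_density c u) * indicator (chart_map c ` B) u * indicator ?V u \<partial>lborel)"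
    using chart_homeo(2)[OF c] by (subst nn_integral_restrict_space) auto
  also have "\<dots> = (\<integral>\<^sup>+ u\<in>chart_map c ` B. ennreal (vol_density c u) \<partial>lborel)"
    using sub by (intro nn_integral_cong) (auto simp: indicator_def)
  finally show ?thesis .
qed

lemma chart_vol_agree:
  assumes c: "c \<in> atlas" and c': "c' \<in> atlas" and B: "B \<in> sets (restrict_space borel M)"
    and BU: "B \<subseteq> chart_dom c" "B \<subseteq> chart_dom c'"
  shows "emeasure (chart_vol c) B = emeasure (chart_vol c') B"
proof -
  let ?S = "chart_map c ` (chart_dom c \<inter> chart_dom c')"
  let ?g = "chart_map c' \<circ> chart_inv c"
  let ?V' = "chart_map c' ` chart_dom c'"
  let ?J = "\<lambda>u. det (matrix (frechet_derivative ?g (at u)))"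
  \<comment> \<open>The density is continuous only on the image of the chart; cutting it off there makes the integrand Borel on the whole space.\<close>
  define f where "f u = ennreal (indicator ?V' u *\<^sub>R vol_density c' u) * indicator (chart_map c' ` B) u" for u
  have gS: "?g ` ?S = chart_map c' ` (chart_dom c' \<inter> chart_dom c)"
    using c by (force simp: image_iff)
  have V': "?V' \<in> sets borel" using chart_homeo(2)[OF c'] by auto
  have f: "f \<in> borel_measurable borel"
    using borel_measurable_continuous_on_indicator[OF V' continuous_on_vol_density[OF c']]
      chart_image_borel[OF c' B BU(2)]
    unfolding f_def by measurable
  have inj: "inj_on ?g ?S"
    using c inj_on_chart[OF c'] by (auto simp: inj_on_def)
  have "emeasure (chart_vol c') B = (\<integral>\<^sup>+ u\<in>?g ` ?S. f u \<partial>lborel)"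
    unfolding emeasure_chart_vol[OF c' B BU(2)] gS f_def
    using BU by (intro nn_integral_cong) (auto simp: indicator_def)
  also have "\<dots> = (\<integral>\<^sup>+ u\<in>?S. ennreal \<bar>?J u\<bar> * f (?g u) \<partial>lborel)"
  proof (rule nn_integral_change_of_variables)
    show "open (?g ` ?S)" unfolding gS using c c' by (rule open_overlap[rotated])
    show "(?g has_derivative frechet_derivative ?g (at u)) (at u)" if "u \<in> ?S" for u
      using transition_C1(1)[OF c c' that] by (simp add: frechet_derivative_works)
  qed (use open_overlap c c' inj f continuous_on_det_transition in auto)
  also have "\<dots> = (\<integral>\<^sup>+ u\<in>chart_map c ` B. ennreal (vol_density c u) \<partial>lborel)"
  proof (rule nn_integral_cong)
    fix u
    show "ennreal \<bar>?J u\<bar> * f (?g u) * indicator ?S u = ennreal (vol_density c u) * indicator (chart_map c ` B) u"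
    proof (cases "u \<in> ?S")
      case True
      then obtain x where x: "x \<in> chart_dom c" "x \<in> chart_dom c'" "u = chart_map c x" by auto
      have gu: "?g u = chart_map c' x" using x c by simp
      have iff: "chart_map c' x \<in> chart_map c' ` B \<longleftrightarrow> x \<in> B" "chart_map c x \<in> chart_map c ` B \<longleftrightarrow> x \<in> B"
        using inj_on_image_mem_iff[OF inj_on_chart[OF c'] x(2) BU(2)]
          inj_on_image_mem_iff[OF inj_on_chart[OF c] x(1) BU(1)] by auto
      have "vol_density c u = \<bar>?J u\<bar> * vol_density c' (chart_map c' x)"
        unfolding x(3) using x c c' by (intro vol_density_transition) (auto simp: charts_at_def)
      then have "ennreal (vol_density c u) = ennreal \<bar>?J u\<bar> * ennreal (vol_density c' (chart_map c' x))"
        by (simp add: ennreal_mult')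
      moreover have "indicator (chart_map c ` B) u = (indicator B x :: ennreal)"
        "indicator (chart_map c' ` B) (chart_map c' x) = (indicator B x :: ennreal)"
        using iff by (simp_all add: indicator_def x(3))
      moreover have "indicator ?S u = (1 :: ennreal)" "indicator ?V' (chart_map c' x) = (1 :: real)"
        using True x by auto
      ultimately show ?thesis
        unfolding f_def gu by (simp add: mult.assoc)
    next
      case False
      then show ?thesis using BU by (auto simp: indicator_def)
    qed
  qed
  also have "\<dots> = emeasure (chart_vol c) B"
    by (simp add: emeasure_chart_vol[OF c B BU(1)])
  finally show ?thesis ..
qed

lemma chart_dom_sets: "c \<in> atlas \<Longrightarrow> chart_dom c \<in> sets (restrict_space borel M)"
proof -
  assume "c \<in> atlas"
  then obtain T where T: "open T" "chart_dom c = M \<inter> T"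
    using chart_homeo(1) by (metis openin_open)
  show ?thesis
    unfolding sets_restrict_space T(2) using borel_open[OF T(1)] by (rule imageI)
qed

lemma is_riemannian_volume_iff:
  "is_riemannian_volume M atlas (induced_metric atlas \<iota>) \<mu> \<longleftrightarrow>
     sets \<mu> = sets (restrict_space borel M) \<and>
     (\<forall>c\<in>atlas. \<forall>B\<in>sets (restrict_space borel M). B \<subseteq> chart_dom c \<longrightarrow> emeasure \<mu> B = emeasure (chart_vol c) B)"
proof -
  have "(\<integral>\<^sup>+ u\<in>chart_map c ` B. ennreal (sqrt (det (gram_matrix atlas (induced_metric atlas \<iota>) c (chart_inv c u)))) \<partial>lborel)
      = emeasure (chart_vol c) B"
    if c: "c \<in> atlas" and B: "B \<in> sets (restrict_space borel M)" "B \<subseteq> chart_dom c" for c B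
    unfolding emeasure_chart_vol[OF c B]
  proof (rule nn_integral_cong)
    fix u
    show "ennreal (sqrt (det (gram_matrix atlas (induced_metric atlas \<iota>) c (chart_inv c u)))) * indicator (chart_map c ` B) u
       = ennreal (vol_density c u) * indicator (chart_map c ` B) u"
      using vol_density_eq[OF c, of u] B by (cases "u \<in> chart_map c ` B") auto
  qed
  then show ?thesis
    unfolding is_riemannian_volume_def by auto
qed

text \<open>The volume measure is introduced by a definite description, so nothing is known about it until
  existence and uniqueness are established. Compactness provides a finite, hence countable, subcover
  for the gluing of the chart measures.\<close>

lemma riemannian_volume_in_chart:
  assumes compact: "compact M" and c: "c \<in> atlas"
  shows "sets (riemannian_volume M atlas (induced_metric atlas \<iota>)) = sets (restrict_space borel M)"
    and "\<And>B. B \<in> sets (restrict_space borel M) \<Longrightarrow> B \<subseteq> chart_dom c \<Longrightarrow>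
          emeasure (riemannian_volume M atlas (induced_metric atlas \<iota>)) B = emeasure (chart_vol c) B"
proof -
  obtain s :: "nat \<Rightarrow> ('m, 'd) chart" where s: "range s \<subseteq> atlas" "M \<subseteq> (\<Union>n. chart_dom (s n))"
  proof -
    have "\<forall>c\<in>atlas. \<exists>T. open T \<and> chart_dom c = M \<inter> T"
      using chart_homeo(1) by (auto simp: openin_open)
    then obtain T where T: "\<And>c. c \<in> atlas \<Longrightarrow> open (T c) \<and> chart_dom c = M \<inter> T c"
      by metis
    have "M \<subseteq> (\<Union>c\<in>atlas. T c)" using atlas_covers T by blast
    then obtain F where F: "F \<subseteq> atlas" "finite F" "M \<subseteq> (\<Union>c\<in>F. T c)"
      using compactE_image[OF compact, of atlas T] T by metis
    \<comment> \<open>Adding \<open>c\<close> keeps the index set nonempty, so that it can be enumerated by the natural numbers.\<close>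
    have "countable (insert c F)" "insert c F \<noteq> {}" using F by (auto intro: countable_finite)
    then have r: "range (from_nat_into (insert c F)) = insert c F"
      by (rule range_from_nat_into[rotated])
    show ?thesis
    proof (rule that)
      show "range (from_nat_into (insert c F)) \<subseteq> atlas" using r F c by auto
      have "M \<subseteq> (\<Union>c\<in>insert c F. chart_dom c)" using F T by blast
      also have "\<dots> = (\<Union>n. chart_dom (from_nat_into (insert c F) n))"
        by (subst r[symmetric]) simp
      finally show "M \<subseteq> (\<Union>n. chart_dom (from_nat_into (insert c F) n))" .
    qed
  qed
  have "\<exists>!\<mu>. is_riemannian_volume M atlas (induced_metric atlas \<iota>) \<mu>"
    unfolding is_riemannian_volume_iff
  proof (rule ex1_glued_measure[where s=s])
    show "space (restrict_space borel M) \<subseteq> (\<Union>n. chart_dom (s n))"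
      using s by (simp add: space_restrict_space)
  qed (assumption | rule chart_dom_sets sets_chart_vol s(1) chart_vol_agree)+
  then have "is_riemannian_volume M atlas (induced_metric atlas \<iota>) (riemannian_volume M atlas (induced_metric atlas \<iota>))"
    unfolding riemannian_volume_def by (rule theI')
  then have vol: "sets (riemannian_volume M atlas (induced_metric atlas \<iota>)) = sets (restrict_space borel M)"
    "\<forall>c\<in>atlas. \<forall>B\<in>sets (restrict_space borel M). B \<subseteq> chart_dom c \<longrightarrow>
        emeasure (riemannian_volume M atlas (induced_metric atlas \<iota>)) B = emeasure (chart_vol c) B"
    unfolding is_riemannian_volume_iff by - (erule conjunct1, erule conjunct2)
  from vol(1) show "sets (riemannian_volume M atlas (induced_metric atlas \<iota>)) = sets (restrict_space borel M)" .
  show "\<And>B. B \<in> sets (restrict_space borel M) \<Longrightarrow> B \<subseteq> chart_dom c \<Longrightarrow>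
          emeasure (riemannian_volume M atlas (induced_metric atlas \<iota>)) B = emeasure (chart_vol c) B"
    using vol(2) c by blast
qed

lemma integral_riemannian_volume_in_chart:
  fixes h :: "'m \<Rightarrow> real"
  assumes compact: "compact M" and c: "c \<in> atlas"
    and h: "h \<in> borel_measurable (restrict_space borel M)"
    and supp: "\<And>y. y \<in> M \<Longrightarrow> y \<notin> chart_dom c \<Longrightarrow> h y = 0"
  shows "(LINT y|riemannian_volume M atlas (induced_metric atlas \<iota>). h y) =
         (LINT u|lborel. indicator (chart_map c ` chart_dom c) u *\<^sub>R (vol_density c u * h (chart_inv c u)))"
proof -
  let ?\<mu> = "riemannian_volume M atlas (induced_metric atlas \<iota>)"
  let ?U = "chart_dom c" and ?V = "chart_map c ` chart_dom c"
  note vol = riemannian_volume_in_chart[OF compact c]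
  have space: "space ?\<mu> = M" "space (chart_vol c) = M"
    using sets_eq_imp_space_eq[OF vol(1)] sets_eq_imp_space_eq[OF sets_chart_vol[of c]]
    by (simp_all add: space_restrict_space)
  have UM: "?U \<inter> M = ?U" using chart_dom_subset[OF c] by auto
  have U: "?U \<inter> space ?\<mu> \<in> sets ?\<mu>" "?U \<inter> space (chart_vol c) \<in> sets (chart_vol c)"
    using chart_dom_sets[OF c] by (simp_all add: space vol(1) UM)
  have eq: "restrict_space ?\<mu> ?U = restrict_space (chart_vol c) ?U"
  proof (rule measure_eqI)
    show "sets (restrict_space ?\<mu> ?U) = sets (restrict_space (chart_vol c) ?U)"
      by (rule sets_restrict_space_cong) (simp add: vol(1))
    fix A assume "A \<in> sets (restrict_space ?\<mu> ?U)"
    then have A: "A \<subseteq> ?U" "A \<in> sets (restrict_space borel M)"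
      using U by (auto simp: sets_restrict_space_iff vol(1))
    then show "emeasure (restrict_space ?\<mu> ?U) A = emeasure (restrict_space (chart_vol c) ?U) A"
      using U vol(2) by (simp add: emeasure_restrict_space)
  qed
  have ind: "indicator ?U y *\<^sub>R h y = h y" if "y \<in> M" for y
    using supp[OF that] by (cases "y \<in> ?U") auto
  have "(LINT y|?\<mu>. h y) = (LINT y|?\<mu>. indicator ?U y *\<^sub>R h y)"
    using ind by (intro Bochner_Integration.integral_cong) (auto simp: space)
  also have "\<dots> = (LINT y|restrict_space ?\<mu> ?U. h y)"
    using U by (subst integral_restrict_space) auto
  also have "\<dots> = (LINT y|chart_vol c. indicator ?U y *\<^sub>R h y)"
    unfolding eq using U by (subst integral_restrict_space) auto
  also have "\<dots> = (LINT y|chart_vol c. h y)"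
    using ind by (intro Bochner_Integration.integral_cong) (auto simp: space)
  also have "\<dots> = (LINT u|density (restrict_space lborel ?V) (\<lambda>u. ennreal (vol_density c u)). h (chart_inv c u))"
    unfolding chart_vol_def using chart_inv_measurable[OF c] h
    by (subst integral_distr) auto
  also have "\<dots> = (LINT u|restrict_space lborel ?V. vol_density c u *\<^sub>R h (chart_inv c u))"
  proof (rule integral_density)
    show "(\<lambda>u. h (chart_inv c u)) \<in> borel_measurable (restrict_space lborel ?V)"
      by (rule measurable_compose[OF chart_inv_measurable[OF c] h])
    show "AE u in restrict_space lborel ?V. 0 \<le> vol_density c u"
      using vol_density_pos[OF c] by (intro AE_I2) (force simp: space_restrict_space)
  qed (rule vol_density_measurable[OF c])
  also have "\<dots> = (LINT u|lborel. indicator ?V u *\<^sub>R (vol_density c u * h (chart_inv c u)))"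
    using chart_homeo(2)[OF c] by (subst integral_restrict_space) auto
  finally show ?thesis .
qed

end

section \<open>The kernel density is determined by the operator\<close>

context embedded_manifold begin

lemma homeomorphic_map_embedding: "homeomorphic_map (top_of_set M) (top_of_set (\<iota> ` M)) \<iota>"
  using embedding by (simp add: C2_embedding_def embedding_map_def)

lemma continuous_on_embedding: "continuous_on M \<iota>"
  using homeomorphic_imp_continuous_map[OF homeomorphic_map_embedding] by (simp add: continuous_map_in_subtopology)

lemma inj_on_embedding: "inj_on \<iota> M"
  using homeomorphic_imp_injective_map[OF homeomorphic_map_embedding] by simp

text \<open>Since an embedding is a homeomorphism onto its image, distances in the ambient Euclidean space
  generate the topology of \<open>M\<close>. They therefore supply bump functions that are continuous on all of
  \<open>M\<close> and supported in a prescribed chart.\<close>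

lemma embedding_neighbourhood:
  assumes W: "openin (top_of_set M) W" and y: "y \<in> W"
  obtains e where "e > 0" "\<And>z. z \<in> M \<Longrightarrow> dist (\<iota> z) (\<iota> y) < e \<Longrightarrow> z \<in> W"
proof -
  have "openin (top_of_set (\<iota> ` M)) (\<iota> ` W)"
    using W homeomorphic_map_openness_eq[OF homeomorphic_map_embedding] by blast
  then obtain e where e: "e > 0" "ball (\<iota> y) e \<inter> \<iota> ` M \<subseteq> \<iota> ` W"
    using y by (metis imageI openin_contains_ball)
  have WM: "W \<subseteq> M"
    using openin_imp_subset[OF W] .
  show ?thesis
  proof (rule that[OF e(1)])
    fix z assume z: "z \<in> M" "dist (\<iota> z) (\<iota> y) < e"
    then have "\<iota> z \<in> \<iota> ` W"
      using e(2) by (auto simp: dist_commute)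
    then show "z \<in> W"
      using inj_on_image_mem_iff[OF inj_on_embedding z(1) WM] by simp
  qed
qed

lemma continuous_on_heat_kernel:
  "continuous_on M (heat_kernel t \<iota> x)"
  unfolding heat_kernel_def divide_inverse by (intro continuous_intros continuous_on_embedding)

end

text \<open>A bump function \<open>f\<close> near \<open>y\<close> that vanishes at \<open>x\<close> turns \<open>L f x\<close> into minus a multiple of the integral
  of \<open>f\<close> against \<open>K(x,\<cdot>) p\<close> times the volume. If the first density were larger at \<open>y\<close>, it would be larger
  on the whole support of a sufficiently concentrated \<open>f\<close>, and the two operators would differ. Both
  directions of the equality follow by exchanging the embeddings.\<close>

lemma kernel_density_not_less:
  fixes M :: "'m::topological_space set" and atlas :: "('m, 'd::finite) chart set"
    and \<iota>\<^sub>1 \<iota>\<^sub>2 :: "'m \<Rightarrow> real^'D" and p :: "'m \<Rightarrow> real"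
  assumes E1: "embedded_manifold M atlas \<iota>\<^sub>1" and E2: "embedded_manifold M atlas \<iota>\<^sub>2"
    and compact: "compact M" and t: "t > 0"
    and p_cont: "continuous_on M p" and p_pos: "\<And>x. x \<in> M \<Longrightarrow> p x > 0"
    and operators_eq: "\<And>f x. continuous_on M f \<Longrightarrow> x \<in> M \<Longrightarrow>
      ext_laplacian M atlas t p (induced_metric atlas \<iota>\<^sub>1) \<iota>\<^sub>1 f x =
      ext_laplacian M atlas t p (induced_metric atlas \<iota>\<^sub>2) \<iota>\<^sub>2 f x"
    and c: "c \<in> atlas" and y: "y \<in> chart_dom c" and x: "x \<in> M" "x \<noteq> y"
  shows "\<not> heat_kernel t \<iota>\<^sub>2 x y * embedded_manifold.vol_density \<iota>\<^sub>2 c (chart_map c y)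
         < heat_kernel t \<iota>\<^sub>1 x y * embedded_manifold.vol_density \<iota>\<^sub>1 c (chart_map c y)"
proof
  interpret E1: embedded_manifold M atlas \<iota>\<^sub>1 by (rule E1)
  interpret E2: embedded_manifold M atlas \<iota>\<^sub>2 by (rule E2)
  let ?U = "chart_dom c" and ?V = "chart_map c ` chart_dom c"
  let ?inv = "chart_inv c" and ?u = "chart_map c y"
  define a where "a u = heat_kernel t \<iota>\<^sub>1 x (?inv u) * E1.vol_density c u
                      - heat_kernel t \<iota>\<^sub>2 x (?inv u) * E2.vol_density c u" for u
  assume "heat_kernel t \<iota>\<^sub>2 x y * E2.vol_density c ?u < heat_kernel t \<iota>\<^sub>1 x y * E1.vol_density c ?u"
  then have a_pos: "a ?u > 0"
    using E1.chart_inverse(1)[OF c y] by (simp add: a_def)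
  have yM: "y \<in> M" using y E1.chart_dom_subset[OF c] by auto
  have inv_M: "?inv u \<in> M" if "u \<in> ?V" for u
    using E1.chart_inverse(2)[OF c that] E1.chart_dom_subset[OF c] by auto
  have pull: "continuous_on ?V (\<lambda>u. h (?inv u))" if "continuous_on M h" for h :: "'m \<Rightarrow> real"
    using inv_M by (intro continuous_on_compose2[OF that E1.continuous_chart_inv[OF c]]) auto
  note pull_K = pull[OF E1.continuous_on_heat_kernel] pull[OF E2.continuous_on_heat_kernel]
  have cont_a: "continuous_on ?V a"
    unfolding a_def using pull_K E1.continuous_on_vol_density[OF c] E2.continuous_on_vol_density[OF c]
    by (intro continuous_intros)
  have "open {u \<in> ?V. a u > 0}"
    using continuous_open_preimage[OF cont_a E1.chart_homeo(2)[OF c] open_greaterThan[of 0]]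
    by (simp add: vimage_def Int_def)
  then obtain l r where box: "?u \<in> box l r" "cbox l r \<subseteq> {u \<in> ?V. a u > 0}"
    using open_contains_cbox[of "{u \<in> ?V. a u > 0}"] a_pos y by (metis (mono_tags, lifting) imageI mem_Collect_eq)
  have boxV: "cbox l r \<subseteq> ?V" "box l r \<subseteq> ?V"
    using box(2) box_subset_cbox[of l r] by auto
  define W where "W = {z \<in> ?U. chart_map c z \<in> box l r}"
  have "openin (top_of_set ?U) W"
  proof -
    have "continuous_on ?U (chart_map c)"
      using E1.chart_homeo(3)[OF c] by (simp add: homeomorphism_def)
    then have "openin (top_of_set ?U) (?U \<inter> chart_map c -` box l r)"
      by (rule continuous_openin_preimage_gen) (rule open_box)
    then show ?thesis by (simp add: W_def vimage_def Int_def)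
  qed
  then have W: "openin (top_of_set M) W"
    using E1.chart_homeo(1)[OF c] by (rule openin_trans)
  have yW: "y \<in> W" using y box by (simp add: W_def)
  obtain e0 where e0: "e0 > 0" "\<And>z. z \<in> M \<Longrightarrow> dist (\<iota>\<^sub>1 z) (\<iota>\<^sub>1 y) < e0 \<Longrightarrow> z \<in> W"
    by (rule E1.embedding_neighbourhood[OF W yW]) (rule that)
  have "\<iota>\<^sub>1 x \<noteq> \<iota>\<^sub>1 y"
    using E1.inj_on_embedding x yM by (auto dest: inj_onD)
  \<comment> \<open>The second bound on the radius forces the bump function to vanish at \<open>x\<close>.\<close>
  define e where "e = min e0 (dist (\<iota>\<^sub>1 x) (\<iota>\<^sub>1 y))"
  have e: "e > 0" "e \<le> e0" "e \<le> dist (\<iota>\<^sub>1 x) (\<iota>\<^sub>1 y)"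
    using e0 \<open>\<iota>\<^sub>1 x \<noteq> \<iota>\<^sub>1 y\<close> by (auto simp: e_def)
  define f where "f z = max 0 (e - dist (\<iota>\<^sub>1 z) (\<iota>\<^sub>1 y))" for z
  have f_cont: "continuous_on M f"
    unfolding f_def by (intro continuous_intros E1.continuous_on_embedding)
  have f_nonneg: "f z \<ge> 0" for z by (simp add: f_def)
  have f_x: "f x = 0" using e by (simp add: f_def)
  have f_y: "f y = e" using e by (simp add: f_def)
  have f_supp: "f z = 0" if "z \<in> M" "z \<notin> W" for z
    using e0(2)[OF that(1)] that e by (force simp: f_def)
  define G where "G k \<rho> u = \<rho> c u * (heat_kernel t k x (?inv u) * (f x - f (?inv u)) * p (?inv u))"
    for k :: "'m \<Rightarrow> real^'D" and \<rho> u
  have chart_integral: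
    "(LINT z|riemannian_volume M atlas (induced_metric atlas k). heat_kernel t k x z * (f x - f z) * p z)
       = integral (cbox l r) (G k (embedded_manifold.vol_density k))"
    "G k (embedded_manifold.vol_density k) integrable_on cbox l r"
    "continuous_on (cbox l r) (G k (embedded_manifold.vol_density k))"
    if k: "embedded_manifold M atlas k" for k
  proof -
    interpret k: embedded_manifold M atlas k by (rule k)
    let ?h = "\<lambda>z. heat_kernel t k x z * (f x - f z) * p z"
    have h_cont: "continuous_on M ?h"
      by (intro continuous_intros k.continuous_on_heat_kernel f_cont p_cont)
    have "continuous_on ?V (G k k.vol_density)"
      unfolding G_def by (intro continuous_intros pull[OF h_cont] k.continuous_on_vol_density[OF c])
    then show G_cont: "continuous_on (cbox l r) (G k k.vol_density)"
      by (rule continuous_on_subset[OF _ boxV(1)])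
    have int: "set_integrable lborel (cbox l r) (G k k.vol_density)"
      unfolding set_integrable_def by (rule borel_integrable_compact[OF compact_cbox G_cont])
    show "G k k.vol_density integrable_on cbox l r"
      using set_borel_integral_eq_integral(1)[OF int] .
    have "(LINT z|riemannian_volume M atlas (induced_metric atlas k). ?h z)
        = (LINT u|lborel. indicator ?V u *\<^sub>R G k k.vol_density u)"
      unfolding G_def
    proof (rule k.integral_riemannian_volume_in_chart[OF compact c])
      show "?h \<in> borel_measurable (restrict_space borel M)"
        by (rule borel_measurable_continuous_on_restrict[OF h_cont])
      show "?h z = 0" if "z \<in> M" "z \<notin> ?U" for z
        using f_supp[of z] that f_x by (simp add: W_def)
    qed
    also have "\<dots> = (LINT u : cbox l r|lborel. G k k.vol_density u)"
      unfolding set_lebesgue_integral_def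
    proof (intro Bochner_Integration.integral_cong refl)
      fix u
      have "G k k.vol_density u = 0" if "u \<in> ?V" "u \<notin> cbox l r"
      proof -
        have "?inv u \<notin> W"
          using E1.chart_inverse(3)[OF c that(1)] that(2) box_subset_cbox[of l r] by (auto simp: W_def)
        then show ?thesis
          using f_supp[OF inv_M[OF that(1)]] f_x by (simp add: G_def)
      qed
      then show "indicator ?V u *\<^sub>R G k k.vol_density u = indicator (cbox l r) u *\<^sub>R G k k.vol_density u"
        using boxV by (auto simp: indicator_def)
    qed
    also have "\<dots> = integral (cbox l r) (G k k.vol_density)"
      by (rule set_borel_integral_eq_integral(2)[OF int])
    finally show "(LINT z|riemannian_volume M atlas (induced_metric atlas k). ?h z) = integral (cbox l r) (G k k.vol_density)" .
  qed
  let ?G1 = "G \<iota>\<^sub>1 E1.vol_density" and ?G2 = "G \<iota>\<^sub>2 E2.vol_density"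
  have "integral (cbox l r) ?G1 = integral (cbox l r) ?G2"
    using operators_eq[OF f_cont x(1)] t
    unfolding ext_laplacian_def chart_integral(1)[OF E1] chart_integral(1)[OF E2] by simp
  then have int0: "((\<lambda>u. ?G2 u - ?G1 u) has_integral 0) (cbox l r)"
    using has_integral_diff[OF integrable_integral[OF chart_integral(2)[OF E2]]
        integrable_integral[OF chart_integral(2)[OF E1]]] by simp
  \<comment> \<open>As \<open>f x = 0\<close>, the integrands carry the sign of \<open>- f\<close>; hence the second minus the first.\<close>
  have diff_eq: "?G2 u - ?G1 u = f (?inv u) * p (?inv u) * a u" for u
    by (simp add: G_def a_def f_x algebra_simps)
  have "?G2 ?u - ?G1 ?u = 0"
  proof (rule has_integral_0_cbox_imp_0[OF _ _ int0])
    show "continuous_on (cbox l r) (\<lambda>u. ?G2 u - ?G1 u)"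
      by (intro continuous_intros chart_integral(3) E1 E2)
    show "0 \<le> ?G2 u - ?G1 u" if "u \<in> box l r" for u
    proof -
      have "u \<in> ?V" "a u > 0" using that box(2) box_subset_cbox[of l r] by auto
      then show ?thesis
        unfolding diff_eq using f_nonneg p_pos[OF inv_M, of u] by (simp add: less_imp_le)
    qed
    show "box l r \<noteq> {}" "?u \<in> cbox l r"
      using box(1) box_subset_cbox[of l r] by auto
  qed
  moreover have "?G2 ?u - ?G1 ?u > 0"
    unfolding diff_eq using a_pos e p_pos[OF yM] y c by (simp add: f_y)
  ultimately show False by simp
qed

section \<open>From distances to metrics\<close>

lemma norm_eq_imp_inner_eq:
  fixes f g :: "'a::real_vector \<Rightarrow> 'b::real_inner"
  assumes lin: "linear f" "linear g" and norm: "\<And>v. norm (f v) = norm (g v)"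
  shows "f v \<bullet> f w = g v \<bullet> g w"
  using norm[of "v + w"] norm[of v] norm[of w]
  by (simp add: dot_norm linear_add[OF lin(1), symmetric] linear_add[OF lin(2), symmetric])

text \<open>Equal chord lengths pass to the limit of difference quotients along every direction.\<close>

lemma derivative_norm_eq:
  fixes f g :: "real^'d::finite \<Rightarrow> real^'D"
  assumes S: "open S" "u \<in> S"
    and f: "(f has_derivative f') (at u)" and g: "(g has_derivative g') (at u)"
    and eq: "\<And>w. w \<in> S \<Longrightarrow> norm (f w - f u) = norm (g w - g u)"
  shows "norm (f' v) = norm (g' v)"
proof -
  have lim: "((\<lambda>s. norm (h (u + s *\<^sub>R v) - h u) / \<bar>s\<bar>) \<longlongrightarrow> norm (h' v)) (at 0)"
    if h: "(h has_derivative h') (at u)" for h h' :: "real^'d \<Rightarrow> real^'D"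
  proof -
    have "((\<lambda>s. u + s *\<^sub>R v) has_derivative (\<lambda>s. s *\<^sub>R v)) (at 0)"
      by (auto intro!: derivative_eq_intros)
    then have "((\<lambda>s. h (u + s *\<^sub>R v)) has_derivative (\<lambda>s. h' (s *\<^sub>R v))) (at 0)"
      using diff_chain_at[of "\<lambda>s. u + s *\<^sub>R v" "\<lambda>s. s *\<^sub>R v" 0 h h'] h by (simp add: o_def)
    moreover have "h' (s *\<^sub>R v) = s *\<^sub>R h' v" for s
      using has_derivative_linear[OF h] by (rule linear_scale)
    ultimately have lim0: "((\<lambda>s. norm (h (u + s *\<^sub>R v) - h u - s *\<^sub>R h' v) / \<bar>s\<bar>) \<longlongrightarrow> 0) (at 0)"
      by (simp add: has_derivative_at)
    have quot: "norm (h (u + s *\<^sub>R v) - h u - s *\<^sub>R h' v) / \<bar>s\<bar> = norm ((h (u + s *\<^sub>R v) - h u) /\<^sub>R s - h' v)"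
      if "s \<noteq> 0" for s
    proof -
      have "(h (u + s *\<^sub>R v) - h u) /\<^sub>R s - h' v = (h (u + s *\<^sub>R v) - h u - s *\<^sub>R h' v) /\<^sub>R s"
        using that by (simp add: scaleR_right_diff_distrib)
      then show ?thesis by (simp add: divide_inverse mult.commute)
    qed
    have "((\<lambda>s. norm ((h (u + s *\<^sub>R v) - h u) /\<^sub>R s - h' v)) \<longlongrightarrow> 0) (at 0)"
      by (rule Lim_transform_eventually[OF lim0]) (auto simp: eventually_at_filter quot)
    then have "((\<lambda>s. (h (u + s *\<^sub>R v) - h u) /\<^sub>R s) \<longlongrightarrow> h' v) (at 0)"
      by (simp add: tendsto_norm_zero_iff LIM_zero_iff)
    then have "((\<lambda>s. norm ((h (u + s *\<^sub>R v) - h u) /\<^sub>R s)) \<longlongrightarrow> norm (h' v)) (at 0)"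
      by (rule tendsto_norm)
    then show ?thesis by (simp add: divide_inverse mult.commute)
  qed
  have "((\<lambda>s. u + s *\<^sub>R v) \<longlongrightarrow> u + 0 *\<^sub>R v) (at 0)"
    by (intro tendsto_intros)
  then have "\<forall>\<^sub>F s in at 0. u + s *\<^sub>R v \<in> S"
    using S by (intro topological_tendstoD) auto
  then have "\<forall>\<^sub>F s in at 0. norm (f (u + s *\<^sub>R v) - f u) / \<bar>s\<bar> = norm (g (u + s *\<^sub>R v) - g u) / \<bar>s\<bar>"
    by eventually_elim (simp add: eq)
  then have "((\<lambda>s. norm (f (u + s *\<^sub>R v) - f u) / \<bar>s\<bar>) \<longlongrightarrow> norm (g' v)) (at 0)"
    by (rule tendsto_cong[THEN iffD2]) (rule lim[OF g])
  with lim[OF f] show ?thesis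
    by (rule tendsto_unique[OF at_neq_bot])
qed

theorem theorem3p6:
  fixes M :: "'m::topological_space set"
    and atlas :: "('m, 'd::finite) chart set"
    and t :: real
    and p :: "'m \<Rightarrow> real"
    and \<iota>\<^sub>1 \<iota>\<^sub>2 :: "'m \<Rightarrow> real^'D"
    and g\<^sub>1 g\<^sub>2 :: "('m, 'd) metric"
  assumes manifold: "smooth_manifold M atlas" and compact: "compact M"
    and t: "t > 0"
    and p_cont: "continuous_on M p" and p_pos: "\<And>x. x \<in> M \<Longrightarrow> p x > 0"
    and emb1: "C2_embedding M atlas \<iota>\<^sub>1" and emb2: "C2_embedding M atlas \<iota>\<^sub>2"
    and g1: "g\<^sub>1 = induced_metric atlas \<iota>\<^sub>1" and g2: "g\<^sub>2 = induced_metric atlas \<iota>\<^sub>2"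
    and operators_eq: "\<And>f x. continuous_on M f \<Longrightarrow> x \<in> M \<Longrightarrow>
      ext_laplacian M atlas t p g\<^sub>1 \<iota>\<^sub>1 f x = ext_laplacian M atlas t p g\<^sub>2 \<iota>\<^sub>2 f x"
  shows "(\<forall>x\<in>M. \<forall>y\<in>M. norm (\<iota>\<^sub>1 x - \<iota>\<^sub>1 y) = norm (\<iota>\<^sub>2 x - \<iota>\<^sub>2 y)) \<and>
    (\<forall>x\<in>M. \<forall>v\<in>tangent_space atlas x. \<forall>w\<in>tangent_space atlas x. g\<^sub>1 x v w = g\<^sub>2 x v w)"
proof -
  have E1: "embedded_manifold M atlas \<iota>\<^sub>1" and E2: "embedded_manifold M atlas \<iota>\<^sub>2"
    using manifold emb1 emb2 by (auto intro!: embedded_manifold.intro charted_manifold.intro embedded_manifold_axioms.intro)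
  interpret E1: embedded_manifold M atlas \<iota>\<^sub>1 by (rule E1)
  interpret E2: embedded_manifold M atlas \<iota>\<^sub>2 by (rule E2)
  note ops = operators_eq[unfolded g1 g2]
  have kd: "heat_kernel t \<iota>\<^sub>1 x y * E1.vol_density c (chart_map c y) =
      heat_kernel t \<iota>\<^sub>2 x y * E2.vol_density c (chart_map c y)"
    if "c \<in> atlas" "y \<in> chart_dom c" "x \<in> M" "x \<noteq> y" for c x y
    using kernel_density_not_less[OF E1 E2 compact t p_cont p_pos ops that]
      kernel_density_not_less[OF E2 E1 compact t p_cont p_pos ops[symmetric] that] by force
  \<comment> \<open>Both kernels equal \<open>1\<close> on the diagonal, so letting the first argument tend to \<open>y\<close> removes the kernels. The limit exists nontrivially because a point of Euclidean space is not isolated.\<close>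
  have dens: "E1.vol_density c (chart_map c y) = E2.vol_density c (chart_map c y)"
    if c: "c \<in> atlas" and y: "y \<in> chart_dom c" for c y
  proof -
    let ?V = "chart_map c ` chart_dom c" and ?u = "chart_map c y"
    have yM: "y \<in> M" and u: "?u \<in> ?V" using y E1.chart_dom_subset[OF c] by auto
    have inv_M: "chart_inv c w \<in> M" if "w \<in> ?V" for w
      using E1.chart_inverse(2)[OF c that] E1.chart_dom_subset[OF c] by auto
    define F where "F w = heat_kernel t \<iota>\<^sub>1 y (chart_inv c w) * E1.vol_density c ?u -
        heat_kernel t \<iota>\<^sub>2 y (chart_inv c w) * E2.vol_density c ?u" for w
    have "continuous_on ?V F"
      unfolding F_def using inv_M
      by (intro continuous_intros continuous_on_compose2[OF E1.continuous_on_heat_kernel E1.continuous_chart_inv[OF c]]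
           continuous_on_compose2[OF E2.continuous_on_heat_kernel E1.continuous_chart_inv[OF c]]) auto
    then have lim: "(F \<longlongrightarrow> F ?u) (at ?u)"
      using u E1.chart_homeo(2)[OF c] by (metis continuous_on_eq_continuous_at isCont_def)
    have "\<forall>\<^sub>F w in at ?u. F w = 0"
    proof -
      have "\<forall>\<^sub>F w in at ?u. w \<in> ?V - {?u}"
        unfolding eventually_at_topological by (rule exI[of _ ?V]) (use u E1.chart_homeo(2)[OF c] in simp)
      then show ?thesis
      proof eventually_elim
        case (elim w)
        from elim have w: "w \<in> ?V" by (rule DiffD1)
        from elim have "w \<noteq> ?u" by (simp only: Diff_iff singleton_iff not_False_eq_True)
        then have "chart_inv c w \<noteq> y"
          using E1.chart_inverse(3)[OF c w] by (elim contrapos_nn) (simp only:)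
        moreover have "heat_kernel t k y z = heat_kernel t k z y" for k :: "'m \<Rightarrow> real^'D" and z
          by (simp add: heat_kernel_def norm_minus_commute)
        ultimately show "F w = 0"
          using kd[OF c y inv_M[OF w]] by (simp add: F_def)
      qed
    qed
    then have "F ?u = 0"
      by (intro tendsto_unique[OF at_neq_bot lim] tendsto_eventually)
    then show ?thesis
      using E1.chart_inverse(1)[OF c y] by (simp add: F_def heat_kernel_def)
  qed
  have norms: "norm (\<iota>\<^sub>1 x - \<iota>\<^sub>1 y) = norm (\<iota>\<^sub>2 x - \<iota>\<^sub>2 y)" if x: "x \<in> M" and y: "y \<in> M" for x y
  proof (cases "x = y")
    case False
    obtain c where c: "c \<in> atlas" "y \<in> chart_dom c"
      using y E1.atlas_covers by auto
    have "E2.vol_density c (chart_map c y) > 0"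
      using c by (intro E2.vol_density_pos) auto
    then have "heat_kernel t \<iota>\<^sub>1 x y = heat_kernel t \<iota>\<^sub>2 x y"
      using kd[OF c x False] dens[OF c] by simp
    then have "(norm (\<iota>\<^sub>1 x - \<iota>\<^sub>1 y))\<^sup>2 = (norm (\<iota>\<^sub>2 x - \<iota>\<^sub>2 y))\<^sup>2"
      using t by (simp add: heat_kernel_def)
    then show ?thesis by simp
  qed simp
  have metrics: "g\<^sub>1 x v w = g\<^sub>2 x v w"
    if x: "x \<in> M" and v: "v \<in> tangent_space atlas x" and w: "w \<in> tangent_space atlas x" for x v w
  proof -
    obtain c where c: "c \<in> atlas" "x \<in> chart_dom c"
      using x E1.atlas_covers by auto
    let ?V = "chart_map c ` chart_dom c" and ?u = "chart_map c x"
    have u: "?u \<in> ?V" and c': "c \<in> charts_at atlas x"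
      using c by (auto simp: charts_at_def)
    have "norm (E1.jac c ?u z) = norm (E2.jac c ?u z)" for z
    proof (rule derivative_norm_eq[OF E1.chart_homeo(2)[OF c(1)] u E1.has_derivative_jac[OF c(1) u] E2.has_derivative_jac[OF c(1) u]])
      fix q assume q: "q \<in> ?V"
      show "norm ((\<iota>\<^sub>1 \<circ> chart_inv c) q - (\<iota>\<^sub>1 \<circ> chart_inv c) ?u) = norm ((\<iota>\<^sub>2 \<circ> chart_inv c) q - (\<iota>\<^sub>2 \<circ> chart_inv c) ?u)"
        unfolding o_def using norms E1.chart_inverse(2)[OF c(1)] q u E1.chart_dom_subset[OF c(1)] by blast
    qed
    then have "E1.jac c ?u (v c) \<bullet> E1.jac c ?u (w c) = E2.jac c ?u (v c) \<bullet> E2.jac c ?u (w c)"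
      by (intro norm_eq_imp_inner_eq E1.linear_jac E2.linear_jac c(1) u)
    then show ?thesis
      using E1.differential_in_chart[OF c'] E2.differential_in_chart[OF c'] v w
      by (simp only: g1 g2 induced_metric_def)
  qed
  show ?thesis
    using norms metrics by blast
qed

end
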